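(* Let $a,b\in\mathbb{R}$ with $a<b$, let $f\in C^2(\mathbb{R})$, and let $x_0\in C^{2+\beta}([a,b])$ for some $\beta\in(0,1)$ satisfy $x_0(a)=-1$, $x_0(b)=1$, $x_{0uu}(a)=f(a)$, $x_{0uu}(b)=f(b)$ and $x_{0u}>0$ in $[a,b]$. Let $x$ be the constructed solution (as defined in the context) of $$x_t=\frac{x_{uu}-f(u)}{x_u^2}\ \text{ in }(a,b)\times(0,\infty),\qquad x(a,t)=-1,\ x(b,t)=1\ (t>0),\qquad x(\cdot,0)=x_0 .$$ Then $$\lim_{t\to\infty}x(\cdot,t)=x^\infty\qquad\text{in }C^1([a,b]),$$ where $x^\infty\in C^2([a,b])$ is defined by $x^\infty_{uu}(u)=f(u)$ for $u\in(a,b)$, $x^\infty(a)=-1$, $x^\infty(b)=1$.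
   Context: Subscripts $u,t$ denote (weak) partial derivatives. For $\varepsilon>0$ let $x_\varepsilon$ denote the unique classical solution in $C^{2,1}([a,b]\times[0,\infty))\cap C^{4,2}([a,b]\times(0,\infty))$ of the regularized problem $$x_{\varepsilon t}=\frac{x_{\varepsilon uu}-f(u)}{x_{\varepsilon u}^2+\varepsilon}\ \text{ in }(a,b)\times(0,\infty),\quad x_\varepsilon(a,t)=-1,\ x_\varepsilon(b,t)=1\ (t>0),\quad x_\varepsilon(\cdot,0)=x_0 .$$ A constructed solution is a function $x$ for which there is a sequence $\varepsilon_k\searrow0$ such that, for every $p\in(1,\infty)$ and $\alpha\in(0,1)$: $x_{\varepsilon_k}\to x$ in $C^0_{loc}([0,\infty);C^{1+\alpha}([a,b]))$, $x_{\varepsilon_k uu}\rightharpoonup x_{uu}$ weakly in $L^p((a,b)\times(0,T))$ for every $T>0$, and $x_{\varepsilon_k t}\to x_t$ weak-$*$ in $L^\infty((a,b)\times(0,\infty))$. Such an $x$ is a weak solution of the problem in the claim, in the sense that $\int_0^\infty\int_a^b x_u^2x_t\varphi=-\int_0^\infty\int_a^b x_u\varphi_u-\int_0^\infty\int_a^b f(u)\varphi$ for all $\varphi\in C_c^\infty((a,b)\times(0,\infty))$, together with the boundary and initial conditions. *)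

theory Defs
  imports "HOL-Analysis.Analysis"
begin

section \<open>Function spaces in one variable\<close>

text \<open>
  Derivatives are taken within the set \<open>I\<close>, hence are one-sided at the end points of a closed
  interval. All norms take values in \<^typ>\<open>ennreal\<close>, so that the suprema are meaningful for
  unbounded functions as well.
\<close>

definition diff_within :: "real set \<Rightarrow> (real \<Rightarrow> real) \<Rightarrow> real \<Rightarrow> real" where
  "diff_within I g = (\<lambda>u. vector_derivative g (at u within I))"

definition Ck_on :: "nat \<Rightarrow> real set \<Rightarrow> (real \<Rightarrow> real) \<Rightarrow> bool" where
  "Ck_on k I g \<longleftrightarrow>
     (\<forall>j<k. (diff_within I ^^ j) g differentiable_on I) \<and>
     continuous_on I ((diff_within I ^^ k) g)"

definition sup_norm :: "real set \<Rightarrow> (real \<Rightarrow> real) \<Rightarrow> ennreal" where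
  "sup_norm I g = (SUP u\<in>I. ennreal \<bar>g u\<bar>)"

definition hoelder_seminorm :: "real \<Rightarrow> real set \<Rightarrow> (real \<Rightarrow> real) \<Rightarrow> ennreal" where
  "hoelder_seminorm \<alpha> I g =
     (SUP (u, v)\<in>{(u, v). u \<in> I \<and> v \<in> I \<and> u \<noteq> v}. ennreal (\<bar>g u - g v\<bar> / \<bar>u - v\<bar> powr \<alpha>))"

definition Ck_hoelder_on :: "nat \<Rightarrow> real \<Rightarrow> real set \<Rightarrow> (real \<Rightarrow> real) \<Rightarrow> bool" where
  "Ck_hoelder_on k \<alpha> I g \<longleftrightarrow>
     Ck_on k I g \<and> hoelder_seminorm \<alpha> I ((diff_within I ^^ k) g) < \<infinity>"

definition C1_norm :: "real set \<Rightarrow> (real \<Rightarrow> real) \<Rightarrow> ennreal" where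
  "C1_norm I g = sup_norm I g + sup_norm I (diff_within I g)"

definition C1_hoelder_norm :: "real \<Rightarrow> real set \<Rightarrow> (real \<Rightarrow> real) \<Rightarrow> ennreal" where
  "C1_hoelder_norm \<alpha> I g = C1_norm I g + hoelder_seminorm \<alpha> I (diff_within I g)"

section \<open>Functions of space and time\<close>

text \<open>Space-time functions are written \<open>y u t\<close>, with \<open>u\<close> the space and \<open>t\<close> the time variable.\<close>

definition pd_u :: "real set \<Rightarrow> (real \<Rightarrow> real \<Rightarrow> real) \<Rightarrow> real \<Rightarrow> real \<Rightarrow> real" where
  "pd_u I y = (\<lambda>u t. vector_derivative (\<lambda>v. y v t) (at u within I))"

definition pd_t :: "real set \<Rightarrow> (real \<Rightarrow> real \<Rightarrow> real) \<Rightarrow> real \<Rightarrow> real \<Rightarrow> real" where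
  "pd_t J y = (\<lambda>u t. vector_derivative (\<lambda>s. y u s) (at t within J))"

text \<open>
  \<open>partials_on N I J y\<close>: the partial derivatives of \<open>y\<close> of all orders \<open>(i, j) \<in> N\<close> (\<open>i\<close> times in
  space, \<open>j\<close> times in time, in any order) exist and are continuous on \<open>I \<times> J\<close>;
  \<open>D i j\<close> is the derivative of order \<open>(i, j)\<close>. The index set \<open>N\<close> is meant to be downward closed.
\<close>

definition partials_on ::
    "(nat \<times> nat) set \<Rightarrow> real set \<Rightarrow> real set \<Rightarrow> (real \<Rightarrow> real \<Rightarrow> real) \<Rightarrow> bool" where
  "partials_on N I J y \<longleftrightarrow>
     (\<exists>D :: nat \<Rightarrow> nat \<Rightarrow> real \<Rightarrow> real \<Rightarrow> real.
        (\<forall>u\<in>I. \<forall>t\<in>J. D 0 0 u t = y u t) \<and>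
        (\<forall>(i, j)\<in>N. continuous_on (I \<times> J) (\<lambda>(u, t). D i j u t)) \<and>
        (\<forall>i j. (Suc i, j) \<in> N \<longrightarrow>
           (\<forall>u\<in>I. \<forall>t\<in>J. ((\<lambda>v. D i j v t) has_real_derivative D (Suc i) j u t) (at u within I))) \<and>
        (\<forall>i j. (i, Suc j) \<in> N \<longrightarrow>
           (\<forall>u\<in>I. \<forall>t\<in>J. ((\<lambda>s. D i j u s) has_real_derivative D i (Suc j) u t) (at t within J))))"

text \<open>The parabolic classes \<open>C\<^bsup>2m,m\<^esup>(I \<times> J)\<close>, where one time derivative counts as two space derivatives.\<close>

definition parabolic_C :: "nat \<Rightarrow> real set \<Rightarrow> real set \<Rightarrow> (real \<Rightarrow> real \<Rightarrow> real) \<Rightarrow> bool" where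
  "parabolic_C m I J y \<longleftrightarrow> partials_on {(i, j). i + 2 * j \<le> 2 * m} I J y"

definition test_function :: "(real \<times> real) set \<Rightarrow> (real \<Rightarrow> real \<Rightarrow> real) \<Rightarrow> bool" where
  "test_function \<Omega> \<phi> \<longleftrightarrow>
     partials_on UNIV UNIV UNIV \<phi> \<and>
     (\<exists>K. compact K \<and> K \<subseteq> \<Omega> \<and> (\<forall>u t. (u, t) \<notin> K \<longrightarrow> \<phi> u t = 0))"

text \<open>
  Elements of Lebesgue spaces are represented by Borel functions; every class of almost
  everywhere equal Lebesgue measurable functions has such a representative.
\<close>

abbreviation borel_on :: "(real \<times> real) set \<Rightarrow> (real \<times> real) measure" where
  "borel_on \<Omega> \<equiv> restrict_space lborel \<Omega>"

definition weak_partial ::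
    "nat \<Rightarrow> nat \<Rightarrow> (real \<times> real) set \<Rightarrow> (real \<Rightarrow> real \<Rightarrow> real) \<Rightarrow> (real \<Rightarrow> real \<Rightarrow> real) \<Rightarrow> bool" where
  "weak_partial i j \<Omega> v w \<longleftrightarrow>
     (\<forall>K. compact K \<and> K \<subseteq> \<Omega> \<longrightarrow>
        integrable (borel_on K) (\<lambda>(u, t). v u t) \<and> integrable (borel_on K) (\<lambda>(u, t). w u t)) \<and>
     (\<forall>\<phi>. test_function \<Omega> \<phi> \<longrightarrow>
        (LINT (u, t)|borel_on \<Omega>. v u t * (pd_u UNIV ^^ i) ((pd_t UNIV ^^ j) \<phi>) u t) =
        (-1) ^ (i + j) * (LINT (u, t)|borel_on \<Omega>. w u t * \<phi> u t))"

definition Lp_on :: "real \<Rightarrow> (real \<times> real) set \<Rightarrow> (real \<Rightarrow> real \<Rightarrow> real) \<Rightarrow> bool" where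
  "Lp_on p \<Omega> g \<longleftrightarrow>
     (\<lambda>(u, t). g u t) \<in> borel_measurable (borel_on \<Omega>) \<and>
     integrable (borel_on \<Omega>) (\<lambda>(u, t). \<bar>g u t\<bar> powr p)"

definition Linfty_on :: "(real \<times> real) set \<Rightarrow> (real \<Rightarrow> real \<Rightarrow> real) \<Rightarrow> bool" where
  "Linfty_on \<Omega> g \<longleftrightarrow>
     (\<lambda>(u, t). g u t) \<in> borel_measurable (borel_on \<Omega>) \<and>
     (\<exists>C. AE (u, t) in borel_on \<Omega>. \<bar>g u t\<bar> \<le> C)"

definition weakly_conv_Lp ::
    "real \<Rightarrow> (real \<times> real) set \<Rightarrow> (nat \<Rightarrow> real \<Rightarrow> real \<Rightarrow> real) \<Rightarrow> (real \<Rightarrow> real \<Rightarrow> real) \<Rightarrow> bool" where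
  "weakly_conv_Lp p \<Omega> g l \<longleftrightarrow>
     (\<forall>k. Lp_on p \<Omega> (g k)) \<and> Lp_on p \<Omega> l \<and>
     (\<forall>\<psi>. Lp_on (p / (p - 1)) \<Omega> \<psi> \<longrightarrow>
        (\<lambda>k. LINT (u, t)|borel_on \<Omega>. g k u t * \<psi> u t)
          \<longlonglongrightarrow> (LINT (u, t)|borel_on \<Omega>. l u t * \<psi> u t))"

definition weak_star_conv_Linfty ::
    "(real \<times> real) set \<Rightarrow> (nat \<Rightarrow> real \<Rightarrow> real \<Rightarrow> real) \<Rightarrow> (real \<Rightarrow> real \<Rightarrow> real) \<Rightarrow> bool" where
  "weak_star_conv_Linfty \<Omega> g l \<longleftrightarrow>
     (\<forall>k. Linfty_on \<Omega> (g k)) \<and> Linfty_on \<Omega> l \<and>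
     (\<forall>\<psi>. Lp_on 1 \<Omega> \<psi> \<longrightarrow>
        (\<lambda>k. LINT (u, t)|borel_on \<Omega>. g k u t * \<psi> u t)
          \<longlonglongrightarrow> (LINT (u, t)|borel_on \<Omega>. l u t * \<psi> u t))"

text \<open>The space \<open>C\<^sup>0([0,\<infinity>); C\<^bsup>1+\<alpha>\<^esup>(I))\<close> and convergence in it, uniform on each \<open>[0,T]\<close>.\<close>

definition C0_C1_hoelder :: "real \<Rightarrow> real set \<Rightarrow> (real \<Rightarrow> real \<Rightarrow> real) \<Rightarrow> bool" where
  "C0_C1_hoelder \<alpha> I y \<longleftrightarrow>
     (\<forall>t\<ge>0. Ck_hoelder_on 1 \<alpha> I (\<lambda>u. y u t)) \<and>
     (\<forall>s\<ge>0. ((\<lambda>t. C1_hoelder_norm \<alpha> I (\<lambda>u. y u t - y u s)) \<longlongrightarrow> 0) (at s within {0..}))"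

definition conv_C0loc_C1_hoelder ::
    "real \<Rightarrow> real set \<Rightarrow> (nat \<Rightarrow> real \<Rightarrow> real \<Rightarrow> real) \<Rightarrow> (real \<Rightarrow> real \<Rightarrow> real) \<Rightarrow> bool" where
  "conv_C0loc_C1_hoelder \<alpha> I y x \<longleftrightarrow>
     (\<forall>k. C0_C1_hoelder \<alpha> I (y k)) \<and> C0_C1_hoelder \<alpha> I x \<and>
     (\<forall>T>0. (\<lambda>k. SUP t\<in>{0..T}. C1_hoelder_norm \<alpha> I (\<lambda>u. y k u t - x u t)) \<longlonglongrightarrow> 0)"

definition conv_C1_at_infinity ::
    "real set \<Rightarrow> (real \<Rightarrow> real \<Rightarrow> real) \<Rightarrow> (real \<Rightarrow> real) \<Rightarrow> bool" where
  "conv_C1_at_infinity I x g \<longleftrightarrow>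
     (\<forall>t\<ge>0. Ck_on 1 I (\<lambda>u. x u t)) \<and> Ck_on 1 I g \<and>
     ((\<lambda>t. C1_norm I (\<lambda>u. x u t - g u)) \<longlongrightarrow> 0) at_top"

section \<open>The problem\<close>

definition regularized_solution ::
    "real \<Rightarrow> real \<Rightarrow> (real \<Rightarrow> real) \<Rightarrow> (real \<Rightarrow> real) \<Rightarrow> real \<Rightarrow> (real \<Rightarrow> real \<Rightarrow> real) \<Rightarrow> bool" where
  "regularized_solution a b f x0 \<epsilon> y \<longleftrightarrow>
     parabolic_C 1 {a..b} {0..} y \<and>
     parabolic_C 2 {a..b} {0<..} y \<and>
     (\<forall>u\<in>{a<..<b}. \<forall>t>0.
        pd_t {0..} y u t =
          ((pd_u {a..b} ^^ 2) y u t - f u) / ((pd_u {a..b} y u t)\<^sup>2 + \<epsilon>)) \<and>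
     (\<forall>t>0. y a t = -1 \<and> y b t = 1) \<and>
     (\<forall>u\<in>{a..b}. y u 0 = x0 u)"

text \<open>
  The solution of the regularized problem is unique only as a function on \<open>[a,b] \<times> [0,\<infinity>)\<close>, so
  it is referred to by the predicate above. The functions \<open>xuu\<close> and \<open>xt\<close> represent the weak
  derivatives of \<open>x\<close>, which are unique up to null sets.
\<close>

definition constructed_solution ::
    "real \<Rightarrow> real \<Rightarrow> (real \<Rightarrow> real) \<Rightarrow> (real \<Rightarrow> real) \<Rightarrow> (real \<Rightarrow> real \<Rightarrow> real) \<Rightarrow> bool" where
  "constructed_solution a b f x0 x \<longleftrightarrow>
     (\<exists>\<epsilon> y xuu xt.
        (\<forall>k. 0 < \<epsilon> k) \<and> decseq \<epsilon> \<and> \<epsilon> \<longlonglongrightarrow> 0 \<and>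
        (\<forall>k. regularized_solution a b f x0 (\<epsilon> k) (y k)) \<and>
        weak_partial 2 0 ({a<..<b} \<times> {0<..}) x xuu \<and>
        weak_partial 0 1 ({a<..<b} \<times> {0<..}) x xt \<and>
        (\<forall>\<alpha>\<in>{0<..<1}. conv_C0loc_C1_hoelder \<alpha> {a..b} y x) \<and>
        (\<forall>p>1. \<forall>T>0.
           weakly_conv_Lp p ({a<..<b} \<times> {0<..<T}) (\<lambda>k. (pd_u {a..b} ^^ 2) (y k)) xuu) \<and>
        weak_star_conv_Linfty ({a<..<b} \<times> {0<..}) (\<lambda>k. pd_t {0..} (y k)) xt)"

definition stationary_solution ::
    "real \<Rightarrow> real \<Rightarrow> (real \<Rightarrow> real) \<Rightarrow> (real \<Rightarrow> real) \<Rightarrow> bool" where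
  "stationary_solution a b f g \<longleftrightarrow>
     Ck_on 2 {a..b} g \<and>
     (\<forall>u\<in>{a<..<b}. (diff_within {a..b} ^^ 2) g u = f u) \<and>
     g a = -1 \<and> g b = 1"

end

theory Submission
  imports Defs
begin

text \<open>
  Let \<open>y\<close> solve the regularized problem and let \<open>g\<close> be the stationary solution. The time derivative
  \<open>w = y\<^sub>t\<close> satisfies a parabolic equation without zero order term, so \<open>\<bar>w\<bar>\<close> is bounded by its
  initial values, uniformly in \<open>\<epsilon>\<close> because \<open>x\<^sub>0\<^sub>u > 0\<close>. Integration by parts gives
  \<open>F' = - 2 \<integral> (y\<^sub>u\<^sup>2 + \<epsilon>) w\<^sup>2\<close> for \<open>F = \<integral> (y\<^sub>u - g\<^sub>u)\<^sup>2\<close>. Hence \<open>F\<close> decreases, \<open>\<integral> y\<^sub>u\<^sup>2\<close> is bounded, and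
  since \<open>y\<^sub>u\<^sub>u - f = (y\<^sub>u\<^sup>2 + \<epsilon>) w\<close> and \<open>y\<^sub>u - g\<^sub>u\<close> has a zero, \<open>y\<^sub>u\<close> and \<open>y\<^sub>u\<^sub>u\<close> are bounded uniformly
  in time and \<open>\<epsilon>\<close>. The dissipation then controls \<open>\<integral> (y\<^sub>u\<^sub>u - f)\<^sup>2\<close> and thus \<open>F\<close>, so \<open>F\<close> decays
  exponentially, and interpolation with the bound on \<open>y\<^sub>u\<^sub>u\<close> makes \<open>sup \<bar>y\<^sub>u - g\<^sub>u\<bar>\<close> decay exponentially.
  All rates are uniform in \<open>\<epsilon>\<close> and survive the limit \<open>\<epsilon> \<rightarrow> 0\<close>.
\<close>

section \<open>Maximum principle and one-dimensional estimates\<close>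

text \<open>If \<open>d\<close> were positive, \<open>h'\<close> would be positive just to the right
  of \<open>u\<close>, and the mean value theorem would give a value of \<open>h\<close> above the
  maximum.\<close>

lemma second_derivative_nonpos_at_max:
  fixes h h' :: "real \<Rightarrow> real"
  assumes u: "u \<in> {a<..<b}"
    and h: "\<And>v. v \<in> {a<..<b} \<Longrightarrow> (h has_real_derivative h' v) (at v)"
    and h': "(h' has_real_derivative d) (at u)"
    and max: "\<And>v. v \<in> {a<..<b} \<Longrightarrow> h v \<le> h u"
  shows "h' u = 0" and "d \<le> 0"
proof -
  obtain r where r: "r > 0" "ball u r \<subseteq> {a<..<b}"
    using u openE[OF open_greaterThanLessThan] by blast
  show h'0: "h' u = 0"
  proof (rule DERIV_local_max[OF h[OF u] r(1)])
    show "\<forall>v. \<bar>u - v\<bar> < r \<longrightarrow> h v \<le> h u"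
      using max r(2) by (auto simp: ball_def dist_real_def subset_iff)
  qed
  show "d \<le> 0"
  proof (rule ccontr)
    assume "\<not> d \<le> 0"
    then obtain e where e: "e > 0" "\<And>s. 0 < s \<Longrightarrow> s < e \<Longrightarrow> h' u < h' (u + s)"
      using DERIV_pos_inc_right[OF h'] by auto
    define s where "s = min e r / 2"
    have s: "0 < s" "s < e" "s < r" using e(1) r(1) by (auto simp: s_def)
    have sub: "v \<in> {a<..<b}" if "u \<le> v" "v \<le> u + s" for v
      using that s(3) r(2) by (auto simp: ball_def dist_real_def subset_iff)
    obtain v where v: "u < v" "v < u + s" "h (u + s) - h u = (u + s - u) * h' v"
      using MVT2[of u "u + s" h h'] s(1) h sub by (metis less_add_same_cancel1)
    have "h' v > 0" using e(2)[of "v - u"] v s h'0 by auto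
    then have "h (u + s) > h u" using v(3) s(1)
      by (smt (verit) mult_pos_pos)
    then show False using max[of "u + s"] sub[of "u + s"] s(1) by auto
  qed
qed

text \<open>Subtracting \<open>d * t\<close> makes the comparison strict. At a maximum of
  \<open>w - d * t\<close> off the parabolic boundary, \<open>wu = 0\<close> and
  \<open>wuu \<le> 0\<close>, so the equation forces \<open>wt \<le> 0\<close> and
  \<open>w - d * t\<close> strictly decreases in time there, which contradicts maximality against
  slightly earlier times.\<close>

lemma parabolic_max_principle:
  fixes w wu wuu wt c q :: "real \<Rightarrow> real \<Rightarrow> real"
  assumes ab: "a < b" and T: "0 < T" and M: "0 \<le> M"
    and cont: "continuous_on ({a..b} \<times> {0..T}) (\<lambda>(u, t). w u t)"
    and wu: "\<And>u t. u \<in> {a<..<b} \<Longrightarrow> 0 < t \<Longrightarrow> t \<le> T \<Longrightarrow>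
               ((\<lambda>v. w v t) has_real_derivative wu u t) (at u)"
    and wuu: "\<And>u t. u \<in> {a<..<b} \<Longrightarrow> 0 < t \<Longrightarrow> t \<le> T \<Longrightarrow>
               ((\<lambda>v. wu v t) has_real_derivative wuu u t) (at u)"
    and wt: "\<And>u t. u \<in> {a<..<b} \<Longrightarrow> 0 < t \<Longrightarrow> t \<le> T \<Longrightarrow>
               ((\<lambda>s. w u s) has_real_derivative wt u t) (at t)"
    and eq: "\<And>u t. u \<in> {a<..<b} \<Longrightarrow> 0 < t \<Longrightarrow> t \<le> T \<Longrightarrow>
               c u t * wt u t = wuu u t + q u t * wu u t"
    and c: "\<And>u t. u \<in> {a<..<b} \<Longrightarrow> 0 < t \<Longrightarrow> t \<le> T \<Longrightarrow> 0 < c u t"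
    and init: "\<And>u. u \<in> {a..b} \<Longrightarrow> w u 0 \<le> M"
    and lat: "\<And>t. 0 < t \<Longrightarrow> t \<le> T \<Longrightarrow> w a t \<le> M \<and> w b t \<le> M"
    and u: "u \<in> {a..b}" and t: "0 \<le> t" "t \<le> T"
  shows "w u t \<le> M"
proof (rule field_le_epsilon)
  fix e :: real assume e: "e > 0"
  \<comment> \<open>With this choice the perturbation \<open>d * t\<close> never exceeds
    \<open>e\<close> on \<open>[0, T]\<close>.\<close>
  define d where "d = e / T"
  have d: "d > 0" using e T by (simp add: d_def)
  have cd: "continuous_on ({a..b} \<times> {0..T}) (\<lambda>z. w (fst z) (snd z) - d * snd z)"
    using cont by (intro continuous_intros) (simp add: case_prod_unfold)
  have "compact ({a..b} \<times> {0..T})" by (intro compact_Times compact_Icc)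
  moreover have "{a..b} \<times> {0..T} \<noteq> {}" using u t by auto
  ultimately obtain z where z: "z \<in> {a..b} \<times> {0..T}"
      "\<forall>y \<in> {a..b} \<times> {0..T}. w (fst y) (snd y) - d * snd y \<le> w (fst z) (snd z) - d * snd z"
    using continuous_attains_sup[OF _ _ cd] by blast
  obtain v s where zv: "z = (v, s)" by (cases z)
  have v: "v \<in> {a..b}" and s: "0 \<le> s" "s \<le> T" using z zv by auto
  have zmax: "w v' s' - d * s' \<le> w v s - d * s" if "v' \<in> {a..b}" "0 \<le> s'" "s' \<le> T" for v' s'
    using z(2) that zv by force
  have "w v s - d * s \<le> M"
  proof (rule ccontr)
    assume gt: "\<not> w v s - d * s \<le> M"
    have ds: "0 \<le> d * s" using d s by simp
    have s0: "0 < s" using gt init[OF v] s by (cases "s = 0") auto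
    have vi: "v \<in> {a<..<b}" using gt lat[OF s0 s(2)] ds v by (cases "v = a \<or> v = b") auto
    have max: "w v' s \<le> w v s" if "v' \<in> {a<..<b}" for v'
      using zmax[of v' s] that s by auto
    have "wu v s = 0" "wuu v s \<le> 0"
      using second_derivative_nonpos_at_max[of v a b "\<lambda>v. w v s" "\<lambda>v. wu v s" "wuu v s"]
        vi wu wuu s0 s(2) max by auto
    then have "c v s * wt v s \<le> 0" using eq[OF vi s0 s(2)] by simp
    then have wt0: "wt v s \<le> 0" using c[OF vi s0 s(2)] by (simp add: mult_le_0_iff)
    have "((\<lambda>r. w v r - d * r) has_real_derivative wt v s - d) (at s)"
      by (auto intro!: derivative_eq_intros wt[OF vi s0 s(2)])
    \<comment> \<open>The maximum may sit at the final time \<open>T\<close>, so the comparison goes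
      backward, where it stays in the cylinder.\<close>
    then obtain r where r: "r > 0" "\<And>h. 0 < h \<Longrightarrow> h < r \<Longrightarrow> w v s - d * s < w v (s - h) - d * (s - h)"
      using DERIV_neg_dec_left[of "\<lambda>r. w v r - d * r" "wt v s - d" s] wt0 d by auto
    define h where "h = min r s / 2"
    have h: "0 < h" "h < r" "h < s" using r(1) s0 by (auto simp: h_def)
    show False using r(2)[OF h(1,2)] zmax[OF v, of "s - h"] h s by auto
  qed
  then have "w u t \<le> M + d * t" using zmax[OF u t] by linarith
  moreover have "d * t \<le> e" using t T e by (auto simp: d_def field_simps)
  ultimately show "w u t \<le> M + e" by linarith
qed

section \<open>Pointwise bounds by integrals of the derivative\<close>

text \<open>Integrate the derivative \<open>2 * p * q\<close> of the square of \<open>p\<close> from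
  the zero \<open>v\<close> to \<open>u\<close> and split the product by Young's inequality with
  weight \<open>\<eta>\<close>. The weight stays free: a constant one yields a Poincare inequality,
  a time-dependent one the decay of the gradient.\<close>

lemma sq_le_weighted_integrals:
  fixes p q :: "real \<Rightarrow> real"
  assumes p: "\<And>u. u \<in> {a..b} \<Longrightarrow> (p has_real_derivative q u) (at u within {a..b})"
    and q: "continuous_on {a..b} q"
    and v: "v \<in> {a..b}" "p v = 0" and u: "u \<in> {a..b}" and \<eta>: "\<eta> > 0"
  shows "(p u)\<^sup>2 \<le> \<eta> * integral {a..b} (\<lambda>s. (p s)\<^sup>2) + integral {a..b} (\<lambda>s. (q s)\<^sup>2) / \<eta>"
proof -
  have cp: "continuous_on {a..b} p"
    using p by (meson DERIV_continuous continuous_on_eq_continuous_within)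
  define k where "k = (\<lambda>s. \<eta> * (p s)\<^sup>2 + (q s)\<^sup>2 / \<eta>)"
  have ck: "continuous_on {a..b} k"
    unfolding k_def using cp q \<eta> by (intro continuous_intros) auto
  have k: "\<bar>2 * p s * q s\<bar> \<le> k s" for s
  proof -
    have "0 \<le> (\<eta> * \<bar>p s\<bar> - \<bar>q s\<bar>)\<^sup>2 / \<eta>" using \<eta> by simp
    also have "\<dots> = k s - 2 * \<bar>p s\<bar> * \<bar>q s\<bar>"
      using \<eta> by (simp add: k_def power2_diff field_simps power2_eq_square)
    finally show ?thesis by (simp add: abs_mult)
  qed
  have k0: "0 \<le> k s" for s using k[of s] by linarith
  have main: "\<bar>(p d)\<^sup>2 - (p c)\<^sup>2\<bar> \<le> integral {a..b} k" if cd: "a \<le> c" "c \<le> d" "d \<le> b" for c d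
  proof -
    have sub: "{c..d} \<subseteq> {a..b}" using cd by auto
    have "((\<lambda>s. 2 * p s * q s) has_integral (p d)\<^sup>2 - (p c)\<^sup>2) {c..d}"
    proof (rule fundamental_theorem_of_calculus[OF cd(2)])
      fix s assume s: "s \<in> {c..d}"
      have "(p has_real_derivative q s) (at s within {c..d})"
        using p s sub DERIV_subset by blast
      then have "((\<lambda>s. (p s)\<^sup>2) has_real_derivative 2 * p s * q s) (at s within {c..d})"
        by (auto intro!: derivative_eq_intros)
      then show "((\<lambda>s. (p s)\<^sup>2) has_vector_derivative 2 * p s * q s) (at s within {c..d})"
        by (simp add: has_real_derivative_iff_has_vector_derivative)
    qed
    then have eq: "(p d)\<^sup>2 - (p c)\<^sup>2 = integral {c..d} (\<lambda>s. 2 * p s * q s)"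
      and int: "(\<lambda>s. 2 * p s * q s) integrable_on {c..d}"
      by (auto simp: integral_unique has_integral_integrable)
    have ik: "k integrable_on {c..d}" "k integrable_on {a..b}"
      using ck continuous_on_subset[OF ck sub] by (auto intro: integrable_continuous_real)
    have "\<bar>(p d)\<^sup>2 - (p c)\<^sup>2\<bar> \<le> integral {c..d} k"
      unfolding eq using integral_norm_bound_integral[OF int ik(1)] k by auto
    also have "\<dots> \<le> integral {a..b} k"
      using integral_subset_le[OF sub ik] k0 by auto
    finally show ?thesis .
  qed
  have "(p u)\<^sup>2 \<le> integral {a..b} k"
    using main[of v u] main[of u v] v u by (cases "v \<le> u") auto
  also have "\<dots> = \<eta> * integral {a..b} (\<lambda>s. (p s)\<^sup>2) + integral {a..b} (\<lambda>s. (q s)\<^sup>2) / \<eta>"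
  proof -
    have "(\<lambda>s. (p s)\<^sup>2) integrable_on {a..b}" "(\<lambda>s. (q s)\<^sup>2) integrable_on {a..b}"
      using cp q by (auto intro!: integrable_continuous_real continuous_intros)
    then show ?thesis unfolding k_def
      by (subst integral_add) (auto intro: integrable_on_mult_right integrable_on_divide)
  qed
  finally show ?thesis .
qed

text \<open>This is the fundamental theorem of calculus from the zero \<open>v\<close>. Integrating
  the majorant over all of \<open>{a..b}\<close> keeps the bound independent of where
  \<open>v\<close> lies.\<close>

lemma abs_le_integral_derivative_bound:
  fixes p q k :: "real \<Rightarrow> real"
  assumes p: "\<And>u. u \<in> {a..b} \<Longrightarrow> (p has_real_derivative q u) (at u within {a..b})"
    and k: "continuous_on {a..b} k" "\<And>s. s \<in> {a..b} \<Longrightarrow> \<bar>q s\<bar> \<le> k s"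
    and v: "v \<in> {a..b}" "p v = 0" and u: "u \<in> {a..b}"
  shows "\<bar>p u\<bar> \<le> integral {a..b} k"
proof -
  have main: "\<bar>p d - p c\<bar> \<le> integral {a..b} k" if cd: "a \<le> c" "c \<le> d" "d \<le> b" for c d
  proof -
    have sub: "{c..d} \<subseteq> {a..b}" using cd by auto
    have "(q has_integral p d - p c) {c..d}"
    proof (rule fundamental_theorem_of_calculus[OF cd(2)])
      fix s assume s: "s \<in> {c..d}"
      have "(p has_real_derivative q s) (at s within {c..d})"
        using p s sub DERIV_subset by blast
      then show "(p has_vector_derivative q s) (at s within {c..d})"
        by (simp add: has_real_derivative_iff_has_vector_derivative)
    qed
    then have eq: "p d - p c = integral {c..d} q" and int: "q integrable_on {c..d}"
      by (auto simp: integral_unique has_integral_integrable)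
    have ik: "k integrable_on {c..d}" "k integrable_on {a..b}"
      using k continuous_on_subset[OF k(1) sub] by (auto intro: integrable_continuous_real)
    have "\<bar>p d - p c\<bar> \<le> integral {c..d} k"
      unfolding eq using integral_norm_bound_integral[OF int ik(1)] k(2) sub by auto
    also have "\<dots> \<le> integral {a..b} k"
      using integral_subset_le[OF sub ik] k(2) abs_ge_zero order_trans by blast
    finally show ?thesis .
  qed
  show ?thesis
    using main[of v u] main[of u v] v u by (cases "v \<le> u") auto
qed

section \<open>Uniform decay for the regularized flow\<close>

text \<open>
  Here \<open>p\<close>, \<open>q\<close>, \<open>w\<close> stand for \<open>y\<^sub>u\<close>, \<open>y\<^sub>u\<^sub>u\<close>, \<open>y\<^sub>t\<close>. The bounds \<open>E\<close>, \<open>M\<close>, \<open>N\<close>, \<open>G\<close> are parameters so that the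
  constants \<open>C\<close>, \<open>K\<close> and \<open>rate\<close> below do not depend on \<open>\<epsilon>\<close> or \<open>y\<close>.
\<close>

locale regularized_flow =
  fixes a b \<epsilon> E M N G :: real and f g g' :: "real \<Rightarrow> real"
    and y p q w wu wuu wt :: "real \<Rightarrow> real \<Rightarrow> real"
  assumes ab: "a < b" and eps: "0 < \<epsilon>" "\<epsilon> \<le> E" and M: "0 \<le> M"
    and cont_p: "continuous_on ({a..b} \<times> {0..}) (\<lambda>(u, t). p u t)"
    and cont_q: "continuous_on ({a..b} \<times> {0..}) (\<lambda>(u, t). q u t)"
    and cont_w: "continuous_on ({a..b} \<times> {0..}) (\<lambda>(u, t). w u t)"
    and cont_wu: "continuous_on ({a..b} \<times> {0<..}) (\<lambda>(u, t). wu u t)"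
    and cont_f: "continuous_on {a..b} f"
    and y_u: "\<And>u t. u \<in> {a..b} \<Longrightarrow> 0 \<le> t \<Longrightarrow>
               ((\<lambda>v. y v t) has_real_derivative p u t) (at u within {a..b})"
    and p_u: "\<And>u t. u \<in> {a..b} \<Longrightarrow> 0 \<le> t \<Longrightarrow>
               ((\<lambda>v. p v t) has_real_derivative q u t) (at u within {a..b})"
    and w_u: "\<And>u t. u \<in> {a..b} \<Longrightarrow> 0 < t \<Longrightarrow>
               ((\<lambda>v. w v t) has_real_derivative wu u t) (at u within {a..b})"
    and wu_u: "\<And>u t. u \<in> {a..b} \<Longrightarrow> 0 < t \<Longrightarrow>
               ((\<lambda>v. wu v t) has_real_derivative wuu u t) (at u within {a..b})"
    and p_t: "\<And>u t. u \<in> {a..b} \<Longrightarrow> 0 < t \<Longrightarrow> ((\<lambda>s. p u s) has_real_derivative wu u t) (at t)"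
    and q_t: "\<And>u t. u \<in> {a..b} \<Longrightarrow> 0 < t \<Longrightarrow> ((\<lambda>s. q u s) has_real_derivative wuu u t) (at t)"
    and w_t: "\<And>u t. u \<in> {a..b} \<Longrightarrow> 0 < t \<Longrightarrow> ((\<lambda>s. w u s) has_real_derivative wt u t) (at t)"
    and pde: "\<And>u t. u \<in> {a..b} \<Longrightarrow> 0 \<le> t \<Longrightarrow> q u t - f u = ((p u t)\<^sup>2 + \<epsilon>) * w u t"
    and y_lateral: "\<And>t. 0 \<le> t \<Longrightarrow> y a t = g a" "\<And>t. 0 \<le> t \<Longrightarrow> y b t = g b"
    and w_lateral: "\<And>t. 0 < t \<Longrightarrow> w a t = 0" "\<And>t. 0 < t \<Longrightarrow> w b t = 0"
    and w_init: "\<And>u. u \<in> {a..b} \<Longrightarrow> \<bar>w u 0\<bar> \<le> M"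
    and g_u: "\<And>u. u \<in> {a..b} \<Longrightarrow> (g has_real_derivative g' u) (at u within {a..b})"
    and g'_u: "\<And>u. u \<in> {a..b} \<Longrightarrow> (g' has_real_derivative f u) (at u within {a..b})"
    and G: "\<And>u. u \<in> {a..b} \<Longrightarrow> \<bar>g' u\<bar> \<le> G"
    and N: "integral {a..b} (\<lambda>u. (p u 0 - g' u)\<^sup>2) \<le> N"
begin

lemma continuous_on_space_slice:
  assumes "continuous_on ({a..b} \<times> S) (\<lambda>(u, t). h u t)" "t \<in> S"
  shows "continuous_on {a..b} (\<lambda>u. h u t)"
proof -
  have "continuous_on {a..b} (\<lambda>u. (u, t))" by (intro continuous_intros)
  then show ?thesis
    using continuous_on_compose2[OF assms(1), of "{a..b}" "\<lambda>u. (u, t)"] assms(2) by auto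
qed

lemma cont_p_slice: "0 \<le> t \<Longrightarrow> continuous_on {a..b} (\<lambda>u. p u t)"
  and cont_q_slice: "0 \<le> t \<Longrightarrow> continuous_on {a..b} (\<lambda>u. q u t)"
  and cont_w_slice: "0 \<le> t \<Longrightarrow> continuous_on {a..b} (\<lambda>u. w u t)"
  using continuous_on_space_slice[OF cont_p] continuous_on_space_slice[OF cont_q]
    continuous_on_space_slice[OF cont_w] by auto

lemma cont_g': "continuous_on {a..b} g'"
  using g'_u by (meson DERIV_continuous continuous_on_eq_continuous_within)

lemma at_interior: "u \<in> {a<..<b} \<Longrightarrow> at u within {a..b} = at u"
  by (rule at_within_interior) (simp add: interior_atLeastAtMost_real)

text \<open>Differentiating the equation in time gives \<open>(p\<^sup>2 + \<epsilon>) w\<^sub>t = w\<^sub>u\<^sub>u - 2 p w w\<^sub>u\<close>, which is linear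
  in the derivatives of \<open>w\<close> without zero order term, so \<open>w\<close> and \<open>- w\<close> obey the maximum principle.\<close>

lemma pde_t:
  assumes "u \<in> {a..b}" "0 < t"
  shows "((p u t)\<^sup>2 + \<epsilon>) * wt u t = wuu u t + (- 2 * p u t * w u t) * wu u t"
proof -
  have "((\<lambda>s. ((p u s)\<^sup>2 + \<epsilon>) * w u s) has_real_derivative
          ((p u t)\<^sup>2 + \<epsilon>) * wt u t + 2 * p u t * wu u t * w u t) (at t)"
    using p_t[OF assms] w_t[OF assms] by (auto intro!: derivative_eq_intros)
  moreover have "((\<lambda>s. ((p u s)\<^sup>2 + \<epsilon>) * w u s) has_real_derivative wuu u t) (at t)"
  proof (rule has_field_derivative_transform_within[of "\<lambda>s. q u s - f u" _ _ _ t])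
    show "((\<lambda>s. q u s - f u) has_real_derivative wuu u t) (at t)"
      using q_t[OF assms] by (auto intro!: derivative_eq_intros)
    fix s assume "dist s t < t"
    then have "0 \<le> s" by (auto simp: dist_real_def)
    then show "q u s - f u = ((p u s)\<^sup>2 + \<epsilon>) * w u s" using pde assms(1) by auto
  qed (use assms in auto)
  ultimately show ?thesis using DERIV_unique by (fastforce simp: algebra_simps)
qed

lemma coeff_pos: "0 < (p u t)\<^sup>2 + \<epsilon>"
  using eps by (simp add: add_nonneg_pos)

lemma abs_w_le:
  assumes u: "u \<in> {a..b}" and t: "0 \<le> t"
  shows "\<bar>w u t\<bar> \<le> M"
proof -
  \<comment> \<open>The horizon must be positive even when \<open>t = 0\<close>.\<close>
  define T where "T = t + 1"
  have T: "0 < T" "t \<le> T" using t by (auto simp: T_def)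
  have cont: "continuous_on ({a..b} \<times> {0..T}) (\<lambda>(u, t). w u t)"
    by (rule continuous_on_subset[OF cont_w]) auto
  have wu: "((\<lambda>v. w v t) has_real_derivative wu u t) (at u)"
    and wuu: "((\<lambda>v. wu v t) has_real_derivative wuu u t) (at u)"
    and wt: "((\<lambda>s. w u s) has_real_derivative wt u t) (at t)"
    and eq: "((p u t)\<^sup>2 + \<epsilon>) * wt u t = wuu u t + (- 2 * p u t * w u t) * wu u t"
    if "u \<in> {a<..<b}" "0 < t" for u t
    using w_u[of u t] wu_u[of u t] w_t[of u t] pde_t[of u t] at_interior[of u] that by auto
  have init: "w u 0 \<le> M" "- w u 0 \<le> M" if "u \<in> {a..b}" for u
    using w_init[OF that] by auto
  have "w u t \<le> M"
    by (rule parabolic_max_principle[OF ab T(1) M cont wu wuu wt eq coeff_pos init(1) _ u t T(2)])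
      (simp_all add: w_lateral M)
  moreover have "- w u t \<le> M"
  proof (rule parabolic_max_principle[OF ab T(1) M _ DERIV_minus[OF wu] DERIV_minus[OF wuu]
        DERIV_minus[OF wt] _ coeff_pos init(2) _ u t T(2)])
    show "continuous_on ({a..b} \<times> {0..T}) (\<lambda>(u, t). - w u t)"
      using continuous_on_minus[OF cont] by (simp add: case_prod_unfold)
    show "((p u t)\<^sup>2 + \<epsilon>) * - wt u t = - wuu u t + (- 2 * p u t * w u t) * - wu u t"
      if "u \<in> {a<..<b}" "0 < t" for u t
      using eq[OF that] by simp
  qed (simp_all add: w_lateral M)
  ultimately show ?thesis by linarith
qed

section \<open>The energy and its dissipation\<close>

text \<open>Since \<open>y\<close> and \<open>g\<close> agree at the end points, this is twice the
  excess of the energy, the integral of \<open>p\<^sup>2 / 2 + f * y\<close>, over its value at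
  \<open>g\<close>. The flow is a weighted gradient flow of that energy.\<close>

definition F :: "real \<Rightarrow> real" where
  "F t = integral {a..b} (\<lambda>u. (p u t - g' u)\<^sup>2)"

definition dissipation :: "real \<Rightarrow> real" where
  "dissipation t = integral {a..b} (\<lambda>u. ((p u t)\<^sup>2 + \<epsilon>) * (w u t)\<^sup>2)"

lemma integrable_dissipation:
  "0 \<le> t \<Longrightarrow> (\<lambda>u. ((p u t)\<^sup>2 + \<epsilon>) * (w u t)\<^sup>2) integrable_on {a..b}"
  using cont_p_slice cont_w_slice by (intro integrable_continuous_real continuous_intros) auto

lemma integrable_F: "0 \<le> t \<Longrightarrow> (\<lambda>u. (p u t - g' u)\<^sup>2) integrable_on {a..b}"
  using cont_p_slice cont_g' by (intro integrable_continuous_real continuous_intros) auto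

lemma dissipation_nonneg: "0 \<le> t \<Longrightarrow> 0 \<le> dissipation t"
  unfolding dissipation_def using eps
  by (intro integral_nonneg integrable_dissipation) auto

lemma F_nonneg: "0 \<le> t \<Longrightarrow> 0 \<le> F t"
  unfolding F_def by (intro integral_nonneg integrable_F) auto

lemma continuous_on_swap_args:
  assumes "continuous_on ({a..b} \<times> S) (\<lambda>(u, t). h u t)"
  shows "continuous_on (S \<times> {a..b}) (\<lambda>(t, u). h u t)"
proof -
  have "continuous_on (S \<times> {a..b}) (\<lambda>z. (snd z, fst z))" by (intro continuous_intros)
  moreover have "(\<lambda>z. (snd z, fst z)) ` (S \<times> {a..b}) \<subseteq> {a..b} \<times> S" by auto
  ultimately show ?thesis
    using continuous_on_compose2[OF assms, of "S \<times> {a..b}" "\<lambda>z. (snd z, fst z)"]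
    by (simp add: case_prod_unfold)
qed

lemma cont_F: "continuous_on {0..} F"
proof -
  have "continuous_on ({0..} \<times> {a..b}) (\<lambda>z. p (snd z) (fst z) - g' (snd z))"
    using continuous_on_swap_args[OF cont_p]
    by (intro continuous_intros continuous_on_compose2[OF cont_g'])
       (auto simp: case_prod_unfold)
  then have "continuous_on ({0..} \<times> cbox a b) (\<lambda>(t, u). (p u t - g' u)\<^sup>2)"
    unfolding case_prod_unfold cbox_interval by (rule continuous_on_power)
  then show ?thesis
    unfolding F_def[abs_def] using integral_continuous_on_param[of "{0..}" a b] by simp
qed

text \<open>The time derivative of \<open>p\<close> is \<open>wu\<close>, so differentiation under
  the integral gives twice the integral of \<open>(p - g') * wu\<close>. Integration by parts moves
  the space derivative to \<open>p - g'\<close>; the boundary terms vanish with \<open>w\<close>,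
  and the equation turns \<open>(q - f) * w\<close> into the dissipation integrand.\<close>

lemma DERIV_F:
  assumes t: "0 < t"
  shows "(F has_real_derivative - 2 * dissipation t) (at t)"
proof -
  have sub: "{0<..} \<times> {a..b} \<subseteq> {0::real..} \<times> {a..b}" by auto
  have c1: "continuous_on ({0<..} \<times> {a..b}) (\<lambda>z. p (snd z) (fst z))"
    using continuous_on_subset[OF continuous_on_swap_args[OF cont_p] sub] by (simp add: case_prod_unfold)
  have c2: "continuous_on ({0<..} \<times> {a..b}) (\<lambda>z. wu (snd z) (fst z))"
    using continuous_on_swap_args[OF cont_wu] by (simp add: case_prod_unfold)
  have "((\<lambda>t. integral (cbox a b) (\<lambda>u. (p u t - g' u)\<^sup>2)) has_real_derivative
          integral (cbox a b) (\<lambda>u. 2 * (p u t - g' u) * wu u t)) (at t within {0<..})"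
  proof (rule leibniz_rule_field_derivative)
    show "((\<lambda>t. (p u t - g' u)\<^sup>2) has_real_derivative 2 * (p u t - g' u) * wu u t) (at t within {0<..})"
      if "t \<in> {0<..}" "u \<in> cbox a b" for t u
      using that by (auto intro!: derivative_eq_intros has_field_derivative_at_within[OF p_t])
    show "(\<lambda>u. (p u t - g' u)\<^sup>2) integrable_on cbox a b" if "t \<in> {0<..}" for t
      using that integrable_F[of t] by auto
    show "continuous_on ({0<..} \<times> cbox a b) (\<lambda>(t, u). 2 * (p u t - g' u) * wu u t)"
      unfolding case_prod_unfold
      by (intro continuous_intros continuous_on_compose2[OF cont_g'])
        (use c1 c2 in auto)
  qed (use t in auto)
  then have "(F has_real_derivative integral {a..b} (\<lambda>u. 2 * (p u t - g' u) * wu u t)) (at t)"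
    using t by (simp add: F_def[abs_def] at_within_open[of t "{0<..}"])
  moreover have "integral {a..b} (\<lambda>u. 2 * (p u t - g' u) * wu u t) = - 2 * dissipation t"
  proof -
    have "((\<lambda>u. (q u t - f u) * w u t + (p u t - g' u) * wu u t) has_integral
            (p b t - g' b) * w b t - (p a t - g' a) * w a t) {a..b}"
    proof (rule fundamental_theorem_of_calculus)
      fix u assume u: "u \<in> {a..b}"
      have "((\<lambda>u. (p u t - g' u) * w u t) has_real_derivative
              (q u t - f u) * w u t + (p u t - g' u) * wu u t) (at u within {a..b})"
        using p_u[OF u] g'_u[OF u] w_u[OF u t] t by (auto intro!: derivative_eq_intros)
      then show "((\<lambda>u. (p u t - g' u) * w u t) has_vector_derivative
              (q u t - f u) * w u t + (p u t - g' u) * wu u t) (at u within {a..b})"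
        by (simp add: has_real_derivative_iff_has_vector_derivative)
    qed (use ab in auto)
    then have "((\<lambda>u. (q u t - f u) * w u t + (p u t - g' u) * wu u t) has_integral 0) {a..b}"
      using w_lateral t by simp
    \<comment> \<open>The subtracted dissipation integrand equals \<open>(q - f) * w\<close> by the
      equation, which leaves only \<open>(p - g') * wu\<close>.\<close>
    from has_integral_mult_right[OF has_integral_diff[OF this
        integrable_integral[OF integrable_dissipation[of t]]], of 2]
    have "((\<lambda>u. 2 * ((q u t - f u) * w u t + (p u t - g' u) * wu u t
             - ((p u t)\<^sup>2 + \<epsilon>) * (w u t)\<^sup>2)) has_integral - 2 * dissipation t) {a..b}"
      using t by (simp add: dissipation_def)
    then have "((\<lambda>u. 2 * (p u t - g' u) * wu u t) has_integral - 2 * dissipation t) {a..b}"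
      by (rule has_integral_eq[rotated]) (use pde t in \<open>simp add: power2_eq_square\<close>)
    then show ?thesis by (rule integral_unique)
  qed
  ultimately show ?thesis by simp
qed

text \<open>\<open>F\<close> has a nonpositive derivative at positive times, and its continuity at
  \<open>0\<close> links it to the initial bound.\<close>

lemma F_le_N:
  assumes t: "0 \<le> t"
  shows "F t \<le> N"
proof -
  have "F t \<le> F 0"
  proof (rule DERIV_nonpos_imp_decreasing_open[OF t])
    show "\<exists>d. (F has_real_derivative d) (at s) \<and> d \<le> 0" if "0 < s" "s < t" for s
      using DERIV_F[OF that(1)] dissipation_nonneg[of s] that
      by (intro exI[of _ "- 2 * dissipation s"]) auto
    show "continuous_on {0..t} F"
      by (rule continuous_on_subset[OF cont_F]) auto
  qed
  then show ?thesis using N by (simp add: F_def)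
qed

text \<open>Rolle's theorem applies to \<open>y - g\<close>, which vanishes at both end points. The
  zero found is the base point for all pointwise gradient bounds.\<close>

lemma exists_critical:
  assumes t: "0 \<le> t"
  shows "\<exists>v\<in>{a..b}. p v t - g' v = 0"
proof -
  define z where "z = (\<lambda>v. y v t - g v)"
  have dz: "(z has_real_derivative p v t - g' v) (at v within {a..b})" if "v \<in> {a..b}" for v
    unfolding z_def using y_u[OF that t] g_u[OF that] by (rule DERIV_diff)
  have "\<exists>v. a < v \<and> v < b \<and> DERIV z v :> 0"
  proof (rule Rolle[OF ab])
    show "z a = z b" using y_lateral t by (simp add: z_def)
    show "continuous_on {a..b} z"
      using dz by (meson DERIV_continuous continuous_on_eq_continuous_within)
    show "z differentiable (at v)" if "a < v" "v < b" for v
      using dz[of v] that at_interior[of v] by (auto simp: real_differentiable_def)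
  qed
  then obtain v where v: "a < v" "v < b" "DERIV z v :> 0" by blast
  then have "p v t - g' v = 0"
    using dz[of v] at_interior[of v] DERIV_unique[OF v(3)] by force
  then show ?thesis using v by auto
qed

section \<open>Bounds uniform in time and in \<open>\<epsilon>\<close>\<close>

text \<open>A bound for the integral of the coefficient \<open>p\<^sup>2 + \<epsilon>\<close>,
  assembled from \<open>F \<le> N\<close>, \<open>\<bar>g'\<bar> \<le> G\<close> and
  \<open>\<epsilon> \<le> E\<close>.\<close>

definition C :: real where "C = 2 * N + 2 * (b - a) * G\<^sup>2 + (b - a) * E"

text \<open>A bound for \<open>\<bar>p\<bar>\<close>, in which \<open>M * C\<close> accounts for the
  distance of \<open>p\<close> from \<open>g'\<close>.\<close>

definition K :: real where "K = M * C + G"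

lemma integral_coeff_le:
  assumes t: "0 \<le> t"
  shows "integral {a..b} (\<lambda>u. (p u t)\<^sup>2 + \<epsilon>) \<le> C"
proof -
  have "integral {a..b} (\<lambda>u. (p u t)\<^sup>2 + \<epsilon>)
      \<le> integral {a..b} (\<lambda>u. 2 * (p u t - g' u)\<^sup>2 + (2 * G\<^sup>2 + E))"
  proof (rule integral_le)
    show "(\<lambda>u. (p u t)\<^sup>2 + \<epsilon>) integrable_on {a..b}"
      using cont_p_slice[OF t] by (intro integrable_continuous_real continuous_intros)
    show "(\<lambda>u. 2 * (p u t - g' u)\<^sup>2 + (2 * G\<^sup>2 + E)) integrable_on {a..b}"
      using cont_p_slice[OF t] cont_g' by (intro integrable_continuous_real continuous_intros)
    fix u assume u: "u \<in> {a..b}"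
    have "(g' u)\<^sup>2 \<le> G\<^sup>2" using G[OF u] by (simp add: abs_le_square_iff[symmetric])
    \<comment> \<open>Expanded, this says that the square of \<open>p\<close> is at most
      \<open>2 * (p - g')\<^sup>2 + 2 * g'\<^sup>2\<close>.\<close>
    moreover have "0 \<le> (p u t - 2 * g' u)\<^sup>2" by simp
    ultimately show "(p u t)\<^sup>2 + \<epsilon> \<le> 2 * (p u t - g' u)\<^sup>2 + (2 * G\<^sup>2 + E)"
      using eps by (simp add: power2_diff)
  qed
  also have "\<dots> = 2 * F t + (b - a) * (2 * G\<^sup>2 + E)"
    unfolding F_def using integrable_F[OF t] ab
    by (subst integral_add) (auto intro: integrable_on_mult_right)
  also have "\<dots> \<le> C" using F_le_N[OF t] by (simp add: C_def algebra_simps)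
  finally show ?thesis .
qed

text \<open>By the equation and the bound on \<open>w\<close>, the derivative \<open>q - f\<close>
  of \<open>p - g'\<close> is at most \<open>M * (p\<^sup>2 + \<epsilon>)\<close> in absolute value.
  The quadratic growth in \<open>p\<close> is harmless because the energy already bounds the
  integral of this majorant by \<open>M * C\<close>.\<close>

lemma abs_p_le:
  assumes u: "u \<in> {a..b}" and t: "0 \<le> t"
  shows "\<bar>p u t\<bar> \<le> K"
proof -
  obtain v where v: "v \<in> {a..b}" "p v t - g' v = 0" using exists_critical[OF t] by blast
  have "\<bar>p u t - g' u\<bar> \<le> integral {a..b} (\<lambda>s. M * ((p s t)\<^sup>2 + \<epsilon>))"
  proof (rule abs_le_integral_derivative_bound[where p = "\<lambda>u. p u t - g' u" and q = "\<lambda>s. q s t - f s", OF _ _ _ v u])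
    show "((\<lambda>u. p u t - g' u) has_real_derivative q u t - f u) (at u within {a..b})"
      if "u \<in> {a..b}" for u using p_u[OF that t] g'_u[OF that] by (rule DERIV_diff)
    show "continuous_on {a..b} (\<lambda>s. M * ((p s t)\<^sup>2 + \<epsilon>))"
      using cont_p_slice[OF t] by (intro continuous_intros)
    show "\<bar>q s t - f s\<bar> \<le> M * ((p s t)\<^sup>2 + \<epsilon>)" if "s \<in> {a..b}" for s
      unfolding pde[OF that t] abs_mult using abs_w_le[OF that t] coeff_pos[of s t]
      by (simp add: mult.commute)
  qed
  also have "\<dots> \<le> M * C"
    using mult_left_mono[OF integral_coeff_le[OF t] M] by simp
  finally show ?thesis using G[OF u] by (simp add: K_def)
qed

lemma coeff_le:
  assumes "u \<in> {a..b}" "0 \<le> t"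
  shows "(p u t)\<^sup>2 + \<epsilon> \<le> K\<^sup>2 + E"
proof -
  have "(p u t)\<^sup>2 \<le> K\<^sup>2" using abs_p_le[OF assms] by (simp add: abs_le_square_iff[symmetric])
  then show ?thesis using eps by simp
qed

lemma KE_pos: "0 < K\<^sup>2 + E" using eps by (simp add: add_nonneg_pos)

lemma sq_gradient_le:
  assumes u: "u \<in> {a..b}" and t: "0 \<le> t" and \<eta>: "\<eta> > 0"
  shows "(p u t - g' u)\<^sup>2 \<le> \<eta> * F t + integral {a..b} (\<lambda>s. (q s t - f s)\<^sup>2) / \<eta>"
proof -
  obtain v where v: "v \<in> {a..b}" "p v t - g' v = 0" using exists_critical[OF t] by blast
  show ?thesis unfolding F_def
  proof (rule sq_le_weighted_integrals[where p = "\<lambda>u. p u t - g' u", OF _ _ v u \<eta>])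
    show "((\<lambda>u. p u t - g' u) has_real_derivative q u t - f u) (at u within {a..b})"
      if "u \<in> {a..b}" for u using p_u[OF that t] g'_u[OF that] by (rule DERIV_diff)
    show "continuous_on {a..b} (\<lambda>u. q u t - f u)"
      using cont_q_slice[OF t] cont_f by (intro continuous_intros)
  qed
qed

lemma integrable_residual: "0 \<le> t \<Longrightarrow> (\<lambda>s. (q s t - f s)\<^sup>2) integrable_on {a..b}"
  using cont_q_slice cont_f by (intro integrable_continuous_real continuous_intros) auto

text \<open>The residual \<open>q - f\<close> contains the coefficient
  \<open>p\<^sup>2 + \<epsilon>\<close> once, hence its square contains it twice; one factor belongs
  to the dissipation, the other is bounded by the uniform gradient estimate.\<close>

lemma integral_residual_le:
  assumes t: "0 \<le> t"
  shows "integral {a..b} (\<lambda>s. (q s t - f s)\<^sup>2) \<le> (K\<^sup>2 + E) * dissipation t"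
proof -
  have "integral {a..b} (\<lambda>s. (q s t - f s)\<^sup>2)
     \<le> integral {a..b} (\<lambda>s. (K\<^sup>2 + E) * (((p s t)\<^sup>2 + \<epsilon>) * (w s t)\<^sup>2))"
  proof (rule integral_le[OF integrable_residual[OF t]])
    show "(\<lambda>s. (K\<^sup>2 + E) * (((p s t)\<^sup>2 + \<epsilon>) * (w s t)\<^sup>2)) integrable_on {a..b}"
      by (intro integrable_on_mult_right integrable_dissipation t)
    fix s assume s: "s \<in> {a..b}"
    have "(q s t - f s)\<^sup>2 = ((p s t)\<^sup>2 + \<epsilon>) * (((p s t)\<^sup>2 + \<epsilon>) * (w s t)\<^sup>2)"
      unfolding pde[OF s t] by (simp add: power2_eq_square)
    also have "\<dots> \<le> (K\<^sup>2 + E) * (((p s t)\<^sup>2 + \<epsilon>) * (w s t)\<^sup>2)"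
      using coeff_le[OF s t] coeff_pos[of s t] by (intro mult_right_mono) auto
    finally show "(q s t - f s)\<^sup>2 \<le> (K\<^sup>2 + E) * (((p s t)\<^sup>2 + \<epsilon>) * (w s t)\<^sup>2)" .
  qed
  then show ?thesis by (simp add: dissipation_def)
qed

section \<open>Exponential decay\<close>

text \<open>The reciprocal of the Poincare constant \<open>4 * (b - a)\<^sup>2\<close> times the
  coefficient bound; \<open>F\<close> decays at twice this rate.\<close>

definition rate :: real where "rate = 1 / (4 * (b - a)\<^sup>2 * (K\<^sup>2 + E))"

lemma rate_pos: "0 < rate"
  using ab KE_pos by (simp add: rate_def)

text \<open>Integrating the pointwise gradient estimate over \<open>{a..b}\<close> gives a Poincare
  inequality for \<open>p - g'\<close>, whose right-hand side is controlled by the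
  dissipation.\<close>

lemma rate_F_le_dissipation:
  assumes t: "0 \<le> t"
  shows "rate * F t \<le> dissipation t"
proof -
  define I where "I = integral {a..b} (\<lambda>s. (q s t - f s)\<^sup>2)"
  \<comment> \<open>This weight makes the \<open>F\<close> term integrate to \<open>F t / 2\<close>,
    which is absorbed on the left.\<close>
  define \<eta> where "\<eta> = 1 / (2 * (b - a))"
  have \<eta>: "0 < \<eta>" using ab by (simp add: \<eta>_def)
  have "F t \<le> integral {a..b} (\<lambda>u. \<eta> * F t + I / \<eta>)"
    unfolding F_def
    by (rule integral_le[OF integrable_F[OF t]])
      (use sq_gradient_le[OF _ t \<eta>] in \<open>auto simp: I_def F_def\<close>)
  also have "\<dots> = F t / 2 + 2 * (b - a)\<^sup>2 * I"
    using ab by (simp add: \<eta>_def field_simps power2_eq_square)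
  finally have "F t \<le> 4 * (b - a)\<^sup>2 * I" by simp
  also have "\<dots> \<le> 4 * (b - a)\<^sup>2 * ((K\<^sup>2 + E) * dissipation t)"
    using integral_residual_le[OF t] unfolding I_def by (intro mult_left_mono) auto
  finally show ?thesis
    using ab KE_pos by (simp add: rate_def pos_divide_le_eq mult.commute mult.left_commute)
qed

lemma F_decay:
  assumes t: "0 \<le> t"
  shows "F t \<le> N * exp (- 2 * rate * t)"
proof -
  \<comment> \<open>Gronwall's argument: the exponential factor makes the differential inequality
    \<open>F' \<le> - 2 * rate * F\<close> say that \<open>H\<close> is nonincreasing.\<close>
  define H where "H = (\<lambda>t. F t * exp (2 * rate * t))"
  have "H t \<le> H 0"
  proof (rule DERIV_nonpos_imp_decreasing_open[OF t])
    show "\<exists>d. (H has_real_derivative d) (at s) \<and> d \<le> 0" if "0 < s" "s < t" for s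
    proof (intro exI conjI)
      show "(H has_real_derivative (2 * (rate * F s - dissipation s)) * exp (2 * rate * s)) (at s)"
        unfolding H_def by (auto intro!: derivative_eq_intros DERIV_F[OF that(1)] simp: algebra_simps)
      show "(2 * (rate * F s - dissipation s)) * exp (2 * rate * s) \<le> 0"
        using rate_F_le_dissipation[of s] that by (simp add: mult_le_0_iff)
    qed
    show "continuous_on {0..t} H" unfolding H_def
      by (intro continuous_intros continuous_on_subset[OF cont_F]) auto
  qed
  then have "F t * exp (2 * rate * t) \<le> N" using N by (simp add: H_def F_def)
  then show ?thesis by (simp add: exp_minus field_simps)
qed

text \<open>The weight \<open>\<eta> = exp (rate * t)\<close> balances the decaying \<open>F\<close> against the merely bounded
  second derivative.\<close>

lemma gradient_decay:
  assumes u: "u \<in> {a..b}" and t: "0 \<le> t"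
  shows "(p u t - g' u)\<^sup>2 \<le> (N + (b - a) * ((K\<^sup>2 + E) * M)\<^sup>2) * exp (- rate * t)"
proof -
  define L where "L = (K\<^sup>2 + E) * M"
  have "integral {a..b} (\<lambda>s. (q s t - f s)\<^sup>2) \<le> integral {a..b} (\<lambda>s. L\<^sup>2)"
  proof (rule integral_le[OF integrable_residual[OF t]])
    fix s assume s: "s \<in> {a..b}"
    have "\<bar>q s t - f s\<bar> \<le> L"
      unfolding pde[OF s t] abs_mult L_def
      using coeff_le[OF s t] coeff_pos[of s t] abs_w_le[OF s t] M KE_pos
      by (intro mult_mono) auto
    then show "(q s t - f s)\<^sup>2 \<le> L\<^sup>2" by (simp add: abs_le_square_iff[symmetric])
  qed auto
  also have "\<dots> = (b - a) * L\<^sup>2" using ab by simp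
  finally have I: "integral {a..b} (\<lambda>s. (q s t - f s)\<^sup>2) \<le> (b - a) * L\<^sup>2" .
  have "(p u t - g' u)\<^sup>2
      \<le> exp (rate * t) * F t + integral {a..b} (\<lambda>s. (q s t - f s)\<^sup>2) / exp (rate * t)"
    by (rule sq_gradient_le[OF u t]) simp
  also have "\<dots> \<le> exp (rate * t) * (N * exp (- 2 * rate * t)) + (b - a) * L\<^sup>2 / exp (rate * t)"
    by (intro add_mono mult_left_mono F_decay t divide_right_mono I) auto
  also have "\<dots> = (N + (b - a) * L\<^sup>2) * exp (- rate * t)"
    by (simp add: exp_minus field_simps flip: exp_add)
  finally show ?thesis by (simp add: L_def)
qed

end

section \<open>Classical regularized solutions\<close>

lemma vector_derivative_Icc_eq:
  fixes h :: "real \<Rightarrow> real"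
  assumes "a < b" "u \<in> {a..b}" "(h has_real_derivative d) (at u within {a..b})"
  shows "vector_derivative h (at u within {a..b}) = d"
  using assms vector_derivative_within_cbox[of a b u h d]
  by (simp add: has_real_derivative_iff_has_vector_derivative)

lemma DERIV_Icc_unique:
  fixes h k :: "real \<Rightarrow> real"
  assumes "a < b" "u \<in> {a..b}" "(h has_real_derivative d) (at u within {a..b})"
    and "(k has_real_derivative e) (at u within {a..b})" "\<And>v. v \<in> {a..b} \<Longrightarrow> h v = k v"
  shows "d = e"
proof -
  have "(h has_real_derivative e) (at u within {a..b})"
    using has_field_derivative_transform_within[OF assms(4), of 1 h] assms(2,5) by simp
  then show ?thesis using vector_derivative_Icc_eq assms by metis
qed

text \<open>A positive time is interior to \<open>S\<close>, so derivatives within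
  \<open>{0..}\<close> and within \<open>{0<..}\<close> become two-sided and can be
  compared.\<close>

lemma DERIV_transform_pos:
  fixes h k :: "real \<Rightarrow> real"
  assumes "0 < t" "(h has_real_derivative d) (at t within S)" "{0<..} \<subseteq> S"
    and "\<And>s. 0 < s \<Longrightarrow> h s = k s"
  shows "(k has_real_derivative d) (at t)"
proof -
  have "t \<in> interior S" using assms(1,3) interior_maximal[of "{0<..}" S] by auto
  from at_within_interior[OF this] have "(h has_real_derivative d) (at t)" using assms(2) by simp
  then show ?thesis
    by (rule has_field_derivative_transform_within_open[of _ _ _ "{0<..}"]) (use assms in auto)
qed

text \<open>Exposes the witness hidden in \<open>partials_on\<close>, so that two families of
  derivatives of the same solution can be matched.\<close>

definition partials_family ::
    "nat \<Rightarrow> real set \<Rightarrow> real set \<Rightarrow> (real \<Rightarrow> real \<Rightarrow> real) \<Rightarrow>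
      (nat \<Rightarrow> nat \<Rightarrow> real \<Rightarrow> real \<Rightarrow> real) \<Rightarrow> bool" where
  "partials_family n I J y D \<longleftrightarrow>
     (\<forall>u\<in>I. \<forall>t\<in>J. D 0 0 u t = y u t) \<and>
     (\<forall>i j. i + 2 * j \<le> n \<longrightarrow> continuous_on (I \<times> J) (\<lambda>(u, t). D i j u t)) \<and>
     (\<forall>i j. Suc i + 2 * j \<le> n \<longrightarrow>
       (\<forall>u\<in>I. \<forall>t\<in>J. ((\<lambda>v. D i j v t) has_real_derivative D (Suc i) j u t) (at u within I))) \<and>
     (\<forall>i j. i + 2 * Suc j \<le> n \<longrightarrow>
       (\<forall>u\<in>I. \<forall>t\<in>J. ((\<lambda>s. D i j u s) has_real_derivative D i (Suc j) u t) (at t within J)))"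

lemma parabolic_C_iff: "parabolic_C m I J y \<longleftrightarrow> (\<exists>D. partials_family (2 * m) I J y D)"
  unfolding parabolic_C_def partials_on_def partials_family_def by (simp add: split_beta)

text \<open>The family \<open>D\<close> reaches \<open>t = 0\<close>, while \<open>H\<close> has the
  higher orders but only for positive times. The mixed derivative \<open>H 1 1\<close> is at once
  the space derivative of \<open>w\<close> and the time derivative of \<open>p\<close>, and likewise
  \<open>H 2 1\<close> for \<open>wu\<close> and \<open>q\<close>.\<close>

lemma regularized_solution_imp_flow:
  fixes f x0 x0' x0'' g g' :: "real \<Rightarrow> real"
  assumes ab: "a < b" and eps: "0 < \<epsilon>" "\<epsilon> \<le> E" and f: "continuous_on {a..b} f"
    and sol: "regularized_solution a b f x0 \<epsilon> y"
    and x0: "\<And>u. u \<in> {a..b} \<Longrightarrow> (x0 has_real_derivative x0' u) (at u within {a..b})"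
    and x0': "\<And>u. u \<in> {a..b} \<Longrightarrow> (x0' has_real_derivative x0'' u) (at u within {a..b})"
    and x0_lateral: "x0 a = -1" "x0 b = 1"
    and m: "0 < m" "\<And>u. u \<in> {a..b} \<Longrightarrow> m \<le> x0' u"
    and R: "\<And>u. u \<in> {a..b} \<Longrightarrow> \<bar>x0'' u - f u\<bar> \<le> R"
    and g: "\<And>u. u \<in> {a..b} \<Longrightarrow> (g has_real_derivative g' u) (at u within {a..b})"
    and g': "\<And>u. u \<in> {a..b} \<Longrightarrow> (g' has_real_derivative f u) (at u within {a..b})"
    and g_lateral: "g a = -1" "g b = 1"
    and G: "\<And>u. u \<in> {a..b} \<Longrightarrow> \<bar>g' u\<bar> \<le> G"
  shows "\<exists>p q w wu wuu wt. regularized_flow a b \<epsilon> E (R / m\<^sup>2)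
           (integral {a..b} (\<lambda>u. (x0' u - g' u)\<^sup>2)) G f g g' y p q w wu wuu wt"
proof -
  have par1: "parabolic_C 1 {a..b} {0..} y" and par2: "parabolic_C 2 {a..b} {0<..} y"
    and eq: "\<And>u t. u \<in> {a<..<b} \<Longrightarrow> 0 < t \<Longrightarrow> pd_t {0..} y u t =
          ((pd_u {a..b} ^^ 2) y u t - f u) / ((pd_u {a..b} y u t)\<^sup>2 + \<epsilon>)"
    and lat: "\<And>t. 0 < t \<Longrightarrow> y a t = -1" "\<And>t. 0 < t \<Longrightarrow> y b t = 1"
    and init: "\<And>u. u \<in> {a..b} \<Longrightarrow> y u 0 = x0 u"
    using sol unfolding regularized_solution_def by blast+
  obtain D H where DD: "partials_family 2 {a..b} {0..} y D"
    and HH: "partials_family 4 {a..b} {0<..} y H"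
    using par1 par2 by (auto simp: parabolic_C_iff)
  have D0: "D 0 0 u t = y u t" if "u \<in> {a..b}" "0 \<le> t" for u t
    using DD that by (simp add: partials_family_def)
  have Dc: "continuous_on ({a..b} \<times> {0..}) (\<lambda>(u, t). D i j u t)" if "i + 2 * j \<le> 2" for i j
    using DD that by (simp add: partials_family_def)
  have Du: "((\<lambda>v. D i j v t) has_real_derivative D (Suc i) j u t) (at u within {a..b})"
    if "Suc i + 2 * j \<le> 2" "u \<in> {a..b}" "0 \<le> t" for i j u t
    using DD that by (simp add: partials_family_def)
  have Dt: "((\<lambda>s. D i j u s) has_real_derivative D i (Suc j) u t) (at t within {0..})"
    if "i + 2 * Suc j \<le> 2" "u \<in> {a..b}" "0 \<le> t" for i j u t
    using DD that by (simp add: partials_family_def)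
  have H0: "H 0 0 u t = y u t" if "u \<in> {a..b}" "0 < t" for u t
    using HH that by (simp add: partials_family_def)
  have Hc: "continuous_on ({a..b} \<times> {0<..}) (\<lambda>(u, t). H i j u t)" if "i + 2 * j \<le> 4" for i j
    using HH that by (simp add: partials_family_def)
  have Hu: "((\<lambda>v. H i j v t) has_real_derivative H (Suc i) j u t) (at u within {a..b})"
    if "Suc i + 2 * j \<le> 4" "u \<in> {a..b}" "0 < t" for i j u t
    using HH that by (simp add: partials_family_def)
  have Ht: "((\<lambda>s. H i j u s) has_real_derivative H i (Suc j) u t) (at t within {0<..})"
    if "i + 2 * Suc j \<le> 4" "u \<in> {a..b}" "0 < t" for i j u t
    using HH that by (simp add: partials_family_def)
  define p q w where "p = D 1 0" and "q = D 2 0" and "w = D 0 1"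
  have y_u: "((\<lambda>v. y v t) has_real_derivative p u t) (at u within {a..b})"
    if "u \<in> {a..b}" "0 \<le> t" for u t
    using has_field_derivative_transform_within[OF Du[of 0 0 u t], of 1 "\<lambda>v. y v t"] D0 that
    by (simp add: p_def)
  have p_u: "((\<lambda>v. p v t) has_real_derivative q u t) (at u within {a..b})"
    if "u \<in> {a..b}" "0 \<le> t" for u t
    using Du[of 1 0 u t] that by (simp add: p_def q_def numeral_2_eq_2)
  have y_t: "((\<lambda>s. y u s) has_real_derivative w u t) (at t)"
    if "u \<in> {a..b}" "0 < t" for u t
    by (rule DERIV_transform_pos[OF that(2), where h = "\<lambda>s. D 0 0 u s" and S = "{0..}"])
      (use Dt[of 0 0 u t] D0 that in \<open>auto simp: w_def\<close>)
  \<comment> \<open>Uniqueness of derivatives identifies the two families order by order where both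
    are defined.\<close>
  have Hp: "H 1 0 u t = p u t" if "u \<in> {a..b}" "0 < t" for u t
    using DERIV_Icc_unique[OF ab that(1) Hu[of 0 0 u t] y_u[of u t]] H0 that by simp
  have Hq: "H 2 0 u t = q u t" if "u \<in> {a..b}" "0 < t" for u t
    using DERIV_Icc_unique[OF ab that(1) Hu[of 1 0 u t] p_u[of u t]] Hp that
    by (simp add: numeral_2_eq_2)
  have Hw: "H 0 1 u t = w u t" if "u \<in> {a..b}" "0 < t" for u t
  proof -
    have "((\<lambda>s. y u s) has_real_derivative H 0 1 u t) (at t)"
      by (rule DERIV_transform_pos[OF that(2), where h = "\<lambda>s. H 0 0 u s" and S = "{0<..}"])
        (use Ht[of 0 0 u t] H0 that in auto)
    then show ?thesis using y_t[OF that] DERIV_unique by blast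
  qed
  have pde_interior: "q u t - f u = ((p u t)\<^sup>2 + \<epsilon>) * w u t" if "u \<in> {a<..<b}" "0 < t" for u t
  proof -
    have u: "u \<in> {a..b}" using that by auto
    have 1: "pd_u {a..b} y v t = p v t" if "v \<in> {a..b}" for v
      unfolding pd_u_def by (rule vector_derivative_Icc_eq[OF ab that y_u]) (use that \<open>0 < t\<close> in auto)
    have "((\<lambda>v. pd_u {a..b} y v t) has_real_derivative q u t) (at u within {a..b})"
      using has_field_derivative_transform_within[OF p_u[of u t], of 1 "\<lambda>v. pd_u {a..b} y v t"]
        1 u that by simp
    then have 2: "(pd_u {a..b} ^^ 2) y u t = q u t"
      using vector_derivative_Icc_eq[OF ab u]
      by (simp add: numeral_2_eq_2 pd_u_def[of _ "pd_u {a..b} y"])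
    have "t \<in> interior {0..}" using that by simp
    from at_within_interior[OF this] have 3: "pd_t {0..} y u t = w u t"
      using y_t[OF u that(2)]
      by (simp add: pd_t_def vector_derivative_at has_real_derivative_iff_has_vector_derivative)
    have "0 < (p u t)\<^sup>2 + \<epsilon>" using eps by (simp add: add_nonneg_pos)
    then show ?thesis using eq[OF that] 1[OF u] 2 3 by (simp add: field_simps)
  qed
  have c: "continuous_on ({a..b} \<times> {0..}) (\<lambda>z. p (fst z) (snd z))"
    "continuous_on ({a..b} \<times> {0..}) (\<lambda>z. q (fst z) (snd z))"
    "continuous_on ({a..b} \<times> {0..}) (\<lambda>z. w (fst z) (snd z))"
    using Dc[of 1 0] Dc[of 2 0] Dc[of 0 1] by (simp_all add: p_def q_def w_def case_prod_unfold)
  \<comment> \<open>Both sides are continuous up to the boundary, so the equation extends by density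
    to the end points and to \<open>t = 0\<close>, where it ties \<open>w\<close> to the initial
    data.\<close>
  have pde: "q u t - f u = ((p u t)\<^sup>2 + \<epsilon>) * w u t" if "u \<in> {a..b}" "0 \<le> t" for u t
  proof -
    have cl: "closure ({a<..<b} \<times> {0<..}) = {a..b} \<times> {0::real..}"
      using ab by (simp add: closure_Times)
    have "continuous_on (closure ({a<..<b} \<times> {0<..}))
        (\<lambda>z. q (fst z) (snd z) - f (fst z) - ((p (fst z) (snd z))\<^sup>2 + \<epsilon>) * w (fst z) (snd z))"
      unfolding cl by (intro continuous_intros c continuous_on_compose2[OF f]) auto
    from continuous_constant_on_closure[OF this, of 0 "(u, t)"]
    show ?thesis using pde_interior that by (auto simp: cl)
  qed
  have w0: "w u t = 0" if "u = a \<or> u = b" "0 < t" for u t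
  proof -
    have "((\<lambda>s. y u s) has_real_derivative 0) (at t)"
      \<comment> \<open>The lateral values are constant for positive times; time \<open>1\<close> is
        just a sample.\<close>
      by (rule DERIV_transform_pos[OF that(2), where h = "\<lambda>s. y u 1" and S = UNIV])
        (use lat that in auto)
    then show ?thesis using y_t[of u t] DERIV_unique that ab by force
  qed
  have p0: "p u 0 = x0' u" if "u \<in> {a..b}" for u
    using DERIV_Icc_unique[OF ab that y_u[of u 0] x0] init that by simp
  have q0: "q u 0 = x0'' u" if "u \<in> {a..b}" for u
    using DERIV_Icc_unique[OF ab that p_u[of u 0] x0'] p0 that by simp
  have R0: "0 \<le> R" using R[of a] ab by auto
  have winit: "\<bar>w u 0\<bar> \<le> R / m\<^sup>2" if u: "u \<in> {a..b}" for u
  proof -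
    have "m\<^sup>2 \<le> (x0' u)\<^sup>2" using m(2)[OF u] m(1) by (intro power_mono) auto
    \<comment> \<open>Bounding the coefficient below by \<open>m\<^sup>2\<close> alone makes the
      estimate of the initial \<open>w\<close> independent of \<open>\<epsilon>\<close>.\<close>
    then have "m\<^sup>2 \<le> (x0' u)\<^sup>2 + \<epsilon>" using eps by linarith
    then have "m\<^sup>2 * \<bar>w u 0\<bar> \<le> ((x0' u)\<^sup>2 + \<epsilon>) * \<bar>w u 0\<bar>" by (intro mult_right_mono) auto
    also have "\<dots> = \<bar>x0'' u - f u\<bar>"
      using pde[OF u, of 0] p0[OF u] q0[OF u] eps by (simp add: abs_mult)
    also have "\<dots> \<le> R" by (rule R[OF u])
    finally show ?thesis using m(1) by (simp add: pos_le_divide_eq mult.commute)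
  qed
  have "regularized_flow a b \<epsilon> E (R / m\<^sup>2)
           (integral {a..b} (\<lambda>u. (x0' u - g' u)\<^sup>2)) G f g g' y p q w (H 1 1) (H 2 1) (H 0 2)"
  proof
    show "continuous_on ({a..b} \<times> {0..}) (\<lambda>(u, t). p u t)"
      "continuous_on ({a..b} \<times> {0..}) (\<lambda>(u, t). q u t)"
      "continuous_on ({a..b} \<times> {0..}) (\<lambda>(u, t). w u t)"
      using c by (simp_all add: case_prod_unfold)
    show "continuous_on ({a..b} \<times> {0<..}) (\<lambda>(u, t). H 1 1 u t)" using Hc by simp
    show "((\<lambda>v. w v t) has_real_derivative H 1 1 u t) (at u within {a..b})"
      if "u \<in> {a..b}" "0 < t" for u t
      using has_field_derivative_transform_within[OF Hu[of 0 1 u t], of 1 "\<lambda>v. w v t"] Hw that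
      by simp
    show "((\<lambda>v. H 1 1 v t) has_real_derivative H 2 1 u t) (at u within {a..b})"
      if "u \<in> {a..b}" "0 < t" for u t
      using Hu[of 1 1 u t] that by (simp add: numeral_2_eq_2)
    show "((\<lambda>s. p u s) has_real_derivative H 1 1 u t) (at t)" if "u \<in> {a..b}" "0 < t" for u t
      by (rule DERIV_transform_pos[OF that(2), where h = "\<lambda>s. H 1 0 u s" and S = "{0<..}"])
        (use Ht[of 1 0 u t] Hp that in auto)
    show "((\<lambda>s. q u s) has_real_derivative H 2 1 u t) (at t)" if "u \<in> {a..b}" "0 < t" for u t
      by (rule DERIV_transform_pos[OF that(2), where h = "\<lambda>s. H 2 0 u s" and S = "{0<..}"])
        (use Ht[of 2 0 u t] Hq that in auto)
    show "((\<lambda>s. w u s) has_real_derivative H 0 2 u t) (at t)" if "u \<in> {a..b}" "0 < t" for u t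
      by (rule DERIV_transform_pos[OF that(2), where h = "\<lambda>s. H 0 1 u s" and S = "{0<..}"])
        (use Ht[of 0 1 u t] Hw that in \<open>auto simp: numeral_2_eq_2\<close>)
    show "y a t = g a" "y b t = g b" if "0 \<le> t" for t
      using lat[of t] init ab x0_lateral g_lateral that by (cases "t = 0"; simp)+
    show "integral {a..b} (\<lambda>u. (p u 0 - g' u)\<^sup>2) \<le> integral {a..b} (\<lambda>u. (x0' u - g' u)\<^sup>2)"
      by (rule eq_refl, rule integral_cong) (simp add: p0)
  qed (use ab eps f y_u p_u pde w0 winit g g' G R0 in auto)
  then show ?thesis by blast
qed

section \<open>From the regularity classes to derivatives and back\<close>

lemma Ck_on_1_DERIV:
  assumes "Ck_on 1 S h" "u \<in> S"
  shows "(h has_real_derivative diff_within S h u) (at u within S)"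
proof -
  have "h differentiable (at u within S)"
    using assms by (auto simp: Ck_on_def differentiable_on_def)
  then show ?thesis
    by (simp add: diff_within_def has_real_derivative_iff_has_vector_derivative
        vector_derivative_works)
qed

lemma Ck_on_2_DERIV:
  assumes h: "Ck_on 2 S h"
  shows "u \<in> S \<Longrightarrow> (h has_real_derivative diff_within S h u) (at u within S)"
    and "u \<in> S \<Longrightarrow>
      (diff_within S h has_real_derivative (diff_within S ^^ 2) h u) (at u within S)"
    and "continuous_on S ((diff_within S ^^ 2) h)"
proof -
  have "(diff_within S ^^ 0) h differentiable_on S" "(diff_within S ^^ 1) h differentiable_on S"
    using h unfolding Ck_on_def by (metis zero_less_numeral one_less_numeral_iff semiring_norm(76))+
  then have d: "h differentiable_on S" "diff_within S h differentiable_on S" by simp_all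
  show "(h has_real_derivative diff_within S h u) (at u within S)" if "u \<in> S"
    using d(1) that by (simp add: diff_within_def has_real_derivative_iff_has_vector_derivative
        vector_derivative_works differentiable_on_def)
  show "(diff_within S h has_real_derivative (diff_within S ^^ 2) h u) (at u within S)" if "u \<in> S"
    using d(2) that by (simp add: numeral_2_eq_2 diff_within_def[of _ "diff_within S h"]
        has_real_derivative_iff_has_vector_derivative vector_derivative_works differentiable_on_def)
  show "continuous_on S ((diff_within S ^^ 2) h)" using h by (simp add: Ck_on_def)
qed

lemma diff_within_Icc_eq:
  assumes "a < b" "u \<in> {a..b}" "(h has_real_derivative d) (at u within {a..b})"
  shows "diff_within {a..b} h u = d"
  using vector_derivative_Icc_eq[OF assms] by (simp add: diff_within_def)

lemma Ck_onI_DERIV: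
  assumes ab: "a < b" and f: "continuous_on {a..b} f"
    and g: "\<And>u. u \<in> {a..b} \<Longrightarrow> (g has_real_derivative g' u) (at u within {a..b})"
    and g': "\<And>u. u \<in> {a..b} \<Longrightarrow> (g' has_real_derivative f u) (at u within {a..b})"
  shows "Ck_on 1 {a..b} g" "Ck_on 2 {a..b} g"
    and "u \<in> {a..b} \<Longrightarrow> (diff_within {a..b} ^^ 2) g u = f u"
proof -
  have d: "diff_within {a..b} g u = g' u" if "u \<in> {a..b}" for u
    using diff_within_Icc_eq[OF ab that g[OF that]] .
  have g'': "(diff_within {a..b} g has_real_derivative f u) (at u within {a..b})"
    if "u \<in> {a..b}" for u
    using has_field_derivative_transform_within[OF g'[OF that], of 1 "diff_within {a..b} g"] d that
    by simp
  have dd: "(diff_within {a..b} ^^ 2) g u = f u" if "u \<in> {a..b}" for u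
    using diff_within_Icc_eq[OF ab that g''[OF that]] by (simp add: numeral_2_eq_2)
  then show "u \<in> {a..b} \<Longrightarrow> (diff_within {a..b} ^^ 2) g u = f u" .
  have 1: "g differentiable_on {a..b}" "diff_within {a..b} g differentiable_on {a..b}"
    unfolding differentiable_on_def real_differentiable_def using g g'' by blast+
  then show "Ck_on 1 {a..b} g" by (simp add: Ck_on_def differentiable_imp_continuous_on)
  have "continuous_on {a..b} ((diff_within {a..b} ^^ 2) g)"
    using f dd continuous_on_cong[OF refl] by metis
  then show "Ck_on 2 {a..b} g" using 1 by (auto simp: Ck_on_def less_2_cases_iff)
qed

section \<open>Existence and uniqueness of the stationary solution\<close>

lemma exists_stationary:
  fixes f :: "real \<Rightarrow> real"
  assumes ab: "a < b" and f: "continuous_on {a..b} f"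
  shows "\<exists>g g'. (\<forall>u\<in>{a..b}. (g has_real_derivative g' u) (at u within {a..b})) \<and>
           (\<forall>u\<in>{a..b}. (g' has_real_derivative f u) (at u within {a..b})) \<and> g a = -1 \<and> g b = 1"
proof -
  define I J where "I = (\<lambda>u. integral {a..u} f)" and "J = (\<lambda>u. integral {a..u} I)"
  \<comment> \<open>The slope at \<open>a\<close>, chosen so that the twice integrated
    \<open>f\<close>, started at \<open>-1\<close>, reaches \<open>1\<close> at
    \<open>b\<close>.\<close>
  define A where "A = (2 - J b) / (b - a)"
  have I: "(I has_real_derivative f u) (at u within {a..b})" if "u \<in> {a..b}" for u
    unfolding I_def by (rule integral_has_real_derivative[OF f that])
  then have "continuous_on {a..b} I"
    by (meson DERIV_continuous continuous_on_eq_continuous_within)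
  then have J: "(J has_real_derivative I u) (at u within {a..b})" if "u \<in> {a..b}" for u
    unfolding J_def using that by (rule integral_has_real_derivative)
  show ?thesis
  proof (intro exI conjI ballI)
    show "((\<lambda>u. -1 + A * (u - a) + J u) has_real_derivative A + I u) (at u within {a..b})"
      if "u \<in> {a..b}" for u using J[OF that] by (auto intro!: derivative_eq_intros)
    show "((\<lambda>u. A + I u) has_real_derivative f u) (at u within {a..b})"
      if "u \<in> {a..b}" for u using I[OF that] by (auto intro!: derivative_eq_intros)
  qed (use ab in \<open>auto simp: J_def A_def\<close>)
qed

text \<open>The difference of two solutions has zero second derivative in the open interval, so by
  continuity up to the end points it is affine; it vanishes at both ends.\<close>

lemma stationary_solution_unique:
  assumes ab: "a < b" and g: "stationary_solution a b f g" and h: "stationary_solution a b f h"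
    and u: "u \<in> {a..b}"
  shows "g u = h u"
proof -
  have eq: "(diff_within {a..b} ^^ 2) g v = (diff_within {a..b} ^^ 2) h v" if "v \<in> {a<..<b}" for v
    using g h that by (simp add: stationary_solution_def)
  have C: "Ck_on 2 {a..b} g" "Ck_on 2 {a..b} h" and lat: "g a = h a" "g b = h b"
    using g h by (auto simp: stationary_solution_def)
  define z p where "z = (\<lambda>v. g v - h v)"
    and "p = (\<lambda>v. diff_within {a..b} g v - diff_within {a..b} h v)"
  have z: "(z has_real_derivative p v) (at v within {a..b})" if "v \<in> {a..b}" for v
    unfolding z_def p_def by (intro DERIV_diff Ck_on_2_DERIV C that)
  have p': "(p has_real_derivative (diff_within {a..b} ^^ 2) g v - (diff_within {a..b} ^^ 2) h v)
      (at v within {a..b})" if "v \<in> {a..b}" for v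
    unfolding p_def by (intro DERIV_diff Ck_on_2_DERIV C that)
  have at: "at v within {a..b} = at v" if "v \<in> {a<..<b}" for v
    using that by (intro at_within_interior) (simp add: interior_atLeastAtMost_real)
  have pc: "p v = p a" if "v \<in> {a..b}" for v
  proof (rule DERIV_isconst2[OF ab])
    show "continuous_on {a..b} p"
      using p' by (meson DERIV_continuous continuous_on_eq_continuous_within)
    show "(p has_real_derivative 0) (at v)" if "a < v" "v < b" for v
      using p'[of v] at[of v] eq[of v] that by simp
  qed (use that in auto)
  define k where "k = (\<lambda>v. z v - p a * (v - a))"
  have k': "(k has_real_derivative 0) (at v within {a..b})" if "v \<in> {a..b}" for v
    unfolding k_def using z[OF that] pc[OF that] by (auto intro!: derivative_eq_intros)
  have kc: "k v = k a" if "v \<in> {a..b}" for v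
  proof (rule DERIV_isconst2[OF ab])
    show "continuous_on {a..b} k"
      using k' by (meson DERIV_continuous continuous_on_eq_continuous_within)
    show "(k has_real_derivative 0) (at v)" if "a < v" "v < b" for v
      using k'[of v] at[of v] that by simp
  qed (use that in auto)
  have "p a = 0" using kc[of b] ab lat by (simp add: k_def z_def)
  then show ?thesis using kc[OF u] lat by (simp add: k_def z_def)
qed

section \<open>C1 norms and passage to the limit\<close>

lemma C1_norm_le:
  assumes ab: "a < b"
    and h: "\<And>u. u \<in> {a..b} \<Longrightarrow> (h has_real_derivative h' u) (at u within {a..b})"
    and A: "\<And>u. u \<in> {a..b} \<Longrightarrow> \<bar>h u\<bar> \<le> A" and B: "\<And>u. u \<in> {a..b} \<Longrightarrow> \<bar>h' u\<bar> \<le> B"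
  shows "C1_norm {a..b} h \<le> ennreal (A + B)"
proof -
  have "0 \<le> A" "0 \<le> B" using A[of a] B[of a] ab by auto
  moreover have "sup_norm {a..b} h \<le> ennreal A" "sup_norm {a..b} (diff_within {a..b} h) \<le> ennreal B"
    unfolding sup_norm_def
    using A B diff_within_Icc_eq[OF ab _ h] by (auto intro!: SUP_least ennreal_leI)
  ultimately show ?thesis by (simp add: C1_norm_def ennreal_plus add_mono)
qed

text \<open>Pointwise limits of functions and derivatives are what the passage to the limit uses,
  since the estimates to be transferred are pointwise and uniform in \<open>k\<close>.\<close>

lemma tendsto_of_C1_norm:
  assumes lim: "(\<lambda>k. C1_norm I (h k)) \<longlonglongrightarrow> 0" and u: "u \<in> I"
  shows "(\<lambda>k. h k u) \<longlonglongrightarrow> 0" "(\<lambda>k. diff_within I (h k) u) \<longlonglongrightarrow> 0"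
proof -
  have le: "ennreal \<bar>h k u\<bar> \<le> C1_norm I (h k)"
    "ennreal \<bar>diff_within I (h k) u\<bar> \<le> C1_norm I (h k)" for k
    unfolding C1_norm_def sup_norm_def using u
    by (meson SUP_upper le_iff_add order_trans add_increasing add_increasing2 zero_le)+
  have "(\<lambda>k. ennreal \<bar>h k u\<bar>) \<longlonglongrightarrow> 0"
    by (rule tendsto_sandwich[OF _ _ tendsto_const lim]) (use le in auto)
  then show "(\<lambda>k. h k u) \<longlonglongrightarrow> 0"
    by (simp add: ennreal_tendsto_0_iff tendsto_rabs_zero_iff)
  have "(\<lambda>k. ennreal \<bar>diff_within I (h k) u\<bar>) \<longlonglongrightarrow> 0"
    by (rule tendsto_sandwich[OF _ _ tendsto_const lim]) (use le in auto)
  then show "(\<lambda>k. diff_within I (h k) u) \<longlonglongrightarrow> 0"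
    by (simp add: ennreal_tendsto_0_iff tendsto_rabs_zero_iff)
qed

lemma conv_C0loc_imp_C1_norm:
  assumes "conv_C0loc_C1_hoelder \<alpha> I y x" "0 \<le> t"
  shows "(\<lambda>k. C1_norm I (\<lambda>u. y k u t - x u t)) \<longlonglongrightarrow> 0"
proof -
  define T where "T = t + 1"
  have T: "0 < T" "t \<in> {0..T}" using assms(2) by (auto simp: T_def)
  have lim: "(\<lambda>k. SUP t\<in>{0..T}. C1_hoelder_norm \<alpha> I (\<lambda>u. y k u t - x u t)) \<longlonglongrightarrow> 0"
    using assms(1) T(1) by (auto simp: conv_C0loc_C1_hoelder_def)
  have le: "C1_norm I (\<lambda>u. y k u t - x u t)
     \<le> (SUP t\<in>{0..T}. C1_hoelder_norm \<alpha> I (\<lambda>u. y k u t - x u t))" for k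
    by (rule SUP_upper2[OF T(2)]) (simp add: C1_hoelder_norm_def)
  show ?thesis
    by (rule tendsto_sandwich[OF _ _ tendsto_const lim]) (use le in auto)
qed

section \<open>Convergence to the stationary solution\<close>

theorem theorem1p2:
  fixes a b \<beta> :: real
    and f x0 :: "real \<Rightarrow> real"
    and x :: "real \<Rightarrow> real \<Rightarrow> real"
  assumes "a < b"
    and "Ck_on 2 UNIV f"
    and "\<beta> \<in> {0<..<1}"
    and "Ck_hoelder_on 2 \<beta> {a..b} x0"
    and "x0 a = -1" and "x0 b = 1"
    and "(diff_within {a..b} ^^ 2) x0 a = f a"
    and "(diff_within {a..b} ^^ 2) x0 b = f b"
    and "\<forall>u\<in>{a..b}. diff_within {a..b} x0 u > 0"
    and "constructed_solution a b f x0 x"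
  shows "\<exists>xinf. stationary_solution a b f xinf \<and>
           (\<forall>g. stationary_solution a b f g \<longrightarrow> (\<forall>u\<in>{a..b}. g u = xinf u)) \<and>
           conv_C1_at_infinity {a..b} x xinf"
proof -
  note ab = assms(1)
  have f: "continuous_on {a..b} f"
    using Ck_on_2_DERIV(1)[OF assms(2)]
    by (meson DERIV_continuous_on UNIV_I continuous_on_subset subset_UNIV)
  obtain g g' where g: "\<And>u. u \<in> {a..b} \<Longrightarrow> (g has_real_derivative g' u) (at u within {a..b})"
    and g': "\<And>u. u \<in> {a..b} \<Longrightarrow> (g' has_real_derivative f u) (at u within {a..b})"
    and g_lateral: "g a = -1" "g b = 1"
    using exists_stationary[OF ab f] by blast
  have stat: "stationary_solution a b f g"
    using Ck_onI_DERIV(2,3)[OF ab f g g'] g_lateral by (simp add: stationary_solution_def)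
  have cont: "continuous_on {a..b} h"
    if "\<And>u. u \<in> {a..b} \<Longrightarrow> (h has_real_derivative h' u) (at u within {a..b})" for h h' :: "real \<Rightarrow> real"
    using that by (meson DERIV_continuous continuous_on_eq_continuous_within)
  have bounded: "\<exists>B. \<forall>u\<in>{a..b}. \<bar>h u\<bar> \<le> B" if "continuous_on {a..b} h" for h :: "real \<Rightarrow> real"
    using compact_imp_bounded[OF compact_continuous_image[OF that compact_Icc]]
    by (auto simp: bounded_iff)
  obtain G where G: "\<And>u. u \<in> {a..b} \<Longrightarrow> \<bar>g' u\<bar> \<le> G"
    using bounded[OF cont[OF g']] by blast
  define x0' x0'' where "x0' = diff_within {a..b} x0" and "x0'' = (diff_within {a..b} ^^ 2) x0"
  have "Ck_on 2 {a..b} x0" using assms(4) by (simp add: Ck_hoelder_on_def)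
  note x0_DERIV = Ck_on_2_DERIV[OF this, folded x0'_def x0''_def]
  obtain R where R: "\<And>u. u \<in> {a..b} \<Longrightarrow> \<bar>x0'' u - f u\<bar> \<le> R"
    using bounded[OF continuous_on_diff[OF x0_DERIV(3) f]] by blast
  \<comment> \<open>Compactness turns pointwise positivity of \<open>x0'\<close> into a positive
    lower bound \<open>m\<close>.\<close>
  have "\<exists>v\<in>{a..b}. \<forall>u\<in>{a..b}. x0' v \<le> x0' u"
    using ab by (intro continuous_attains_inf cont[OF x0_DERIV(2)]) auto
  then obtain m where m: "0 < m" "\<And>u. u \<in> {a..b} \<Longrightarrow> m \<le> x0' u"
    using assms(9) unfolding x0'_def by blast
  obtain \<epsilon> y where eps: "\<And>k. 0 < \<epsilon> k" "decseq \<epsilon>"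
    and sol: "\<And>k. regularized_solution a b f x0 (\<epsilon> k) (y k)"
    and conv: "\<And>\<alpha>. \<alpha> \<in> {0<..<1} \<Longrightarrow> conv_C0loc_C1_hoelder \<alpha> {a..b} y x"
    using assms(10) unfolding constructed_solution_def by blast
  \<comment> \<open>The exponent is an arbitrary choice: the Hoelder norm serves only to dominate
    the C1 norm.\<close>
  have conv: "conv_C0loc_C1_hoelder (1/2) {a..b} y x" by (rule conv) simp
  \<comment> \<open>The sequence \<open>\<epsilon>\<close> decreases, so its first term bounds all
    of them and one set of constants serves every \<open>k\<close>.\<close>
  define E M N where "E = \<epsilon> 0" and "M = R / m\<^sup>2"
    and "N = integral {a..b} (\<lambda>u. (x0' u - g' u)\<^sup>2)"
  have "\<exists>p q w wu wuu wt. regularized_flow a b (\<epsilon> k) E M N G f g g' (y k) p q w wu wuu wt" for k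
    unfolding M_def N_def E_def
    by (rule regularized_solution_imp_flow[OF ab eps(1) _ f sol x0_DERIV(1,2) assms(5,6) m R
          g g' g_lateral G]) (auto intro: decseqD[OF eps(2)])
  then obtain p q w wu wuu wt where
    flow: "\<And>k. regularized_flow a b (\<epsilon> k) E M N G f g g' (y k) (p k) (q k) (w k) (wu k) (wuu k) (wt k)"
    by metis
  define K r where "K = regularized_flow.K a b E M N G" and "r = regularized_flow.rate a b E M N G"
  define S where "S = (\<lambda>t. sqrt ((N + (b - a) * ((K\<^sup>2 + E) * M)\<^sup>2) * exp (- r * t)))"
  have r: "0 < r" using regularized_flow.rate_pos[OF flow] by (simp add: r_def)
  have yk: "\<bar>p k u t - g' u\<bar> \<le> S t" if "u \<in> {a..b}" "0 \<le> t" for k u t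
    using regularized_flow.gradient_decay[OF flow that] unfolding S_def K_def r_def
    by (simp add: real_le_rsqrt)
  have Ckx: "Ck_on 1 {a..b} (\<lambda>u. x u t)" if "0 \<le> t" for t
    using conv that by (simp add: conv_C0loc_C1_hoelder_def C0_C1_hoelder_def Ck_hoelder_on_def)
  have C1: "C1_norm {a..b} (\<lambda>u. x u t - g u) \<le> ennreal ((b - a) * S t + S t)" if t: "0 \<le> t" for t
  proof -
    define xu where "xu = diff_within {a..b} (\<lambda>u. x u t)"
    have x_u: "((\<lambda>u. x u t) has_real_derivative xu u) (at u within {a..b})" if "u \<in> {a..b}" for u
      unfolding xu_def by (rule Ck_on_1_DERIV[OF Ckx[OF t] that])
    note lim = tendsto_of_C1_norm[OF conv_C0loc_imp_C1_norm[OF conv t]]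
    have xg: "((\<lambda>u. x u t - g u) has_real_derivative xu u - g' u) (at u within {a..b})"
      if "u \<in> {a..b}" for u using x_u[OF that] g[OF that] by (rule DERIV_diff)
    have grad: "\<bar>xu u - g' u\<bar> \<le> S t" if u: "u \<in> {a..b}" for u
    proof -
      \<comment> \<open>Convergence in C1 concerns the derivative of the difference; written as
        \<open>p k - xu\<close>, it lets the bound \<open>S t\<close> pass to \<open>xu\<close> at
        each point.\<close>
      have "diff_within {a..b} (\<lambda>u. y k u t - x u t) u = p k u t - xu u" for k
        by (rule diff_within_Icc_eq[OF ab u DERIV_diff[OF regularized_flow.y_u[OF flow u t] x_u[OF u]]])
      then have "(\<lambda>k. p k u t) \<longlonglongrightarrow> xu u" using lim(2)[OF u] by (simp add: LIM_zero_iff)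
      then have "(\<lambda>k. \<bar>p k u t - g' u\<bar>) \<longlonglongrightarrow> \<bar>xu u - g' u\<bar>" by (intro tendsto_intros)
      then show ?thesis by (rule LIMSEQ_le_const2) (use yk[OF u t] in auto)
    qed
    have a: "a \<in> {a..b}" using ab by simp
    have "(\<lambda>k. y k a t) \<longlonglongrightarrow> x a t" using lim(1)[OF a] by (simp add: LIM_zero_iff)
    moreover have "y k a t = g a" for k by (rule regularized_flow.y_lateral(1)[OF flow t])
    ultimately have "x a t - g a = 0" using LIMSEQ_unique[OF _ tendsto_const] by fastforce
    \<comment> \<open>With the constant majorant \<open>S t\<close> and the zero at
      \<open>a\<close>, the gradient bound integrates to a bound on \<open>x - g\<close>
      itself.\<close>
    from abs_le_integral_derivative_bound[OF xg _ grad a this]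
    have "\<bar>x u t - g u\<bar> \<le> (b - a) * S t" if "u \<in> {a..b}" for u
      using that ab by simp
    from C1_norm_le[OF ab xg this grad] show ?thesis .
  qed
  have "(S \<longlongrightarrow> sqrt ((N + (b - a) * ((K\<^sup>2 + E) * M)\<^sup>2) * 0)) at_top"
    unfolding S_def
  proof (intro tendsto_intros)
    have "filterlim (\<lambda>t. r * t) at_top at_top"
      using filterlim_tendsto_pos_mult_at_top[OF tendsto_const r filterlim_ident] .
    then show "((\<lambda>t. exp (- r * t)) \<longlongrightarrow> 0) at_top"
      by (intro filterlim_compose[OF exp_at_bot]) (simp add: filterlim_uminus_at_bot)
  qed
  then have "((\<lambda>t. (b - a) * S t + S t) \<longlongrightarrow> (b - a) * 0 + 0) at_top"
    by (intro tendsto_intros) simp_all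
  then have lim: "((\<lambda>t. ennreal ((b - a) * S t + S t)) \<longlongrightarrow> 0) at_top"
    using tendsto_ennrealI by fastforce
  have "((\<lambda>t. C1_norm {a..b} (\<lambda>u. x u t - g u)) \<longlongrightarrow> 0) at_top"
    by (rule tendsto_sandwich[OF _ _ tendsto_const lim])
      (use C1 in \<open>auto intro: eventually_mono[OF eventually_ge_at_top[of 0]]\<close>)
  then have "conv_C1_at_infinity {a..b} x g"
    using Ckx Ck_onI_DERIV(1)[OF ab f g g'] by (simp add: conv_C1_at_infinity_def)
  then show ?thesis using stat stationary_solution_unique[OF ab _ stat] by blast
qed

end
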